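(* Let $p,q$ be positive integers and $n=p+q$. Let $R_\gamma$ and $R_\tau$ be the $\mathbf{B}_n$-orbits in $\mathbf{SL}_n/\mathbf{L}_{p,q}$ corresponding to $(p,q)$-clans $\gamma$ and $\tau$, and let $\pi:\mathbf{SL}_n/\mathbf{L}_{p,q}\to\mathbf{SL}_n/\mathbf{P}_{p,q}$ denote the canonical projection. Then $\pi(R_\gamma)=\pi(R_\tau)$ if and only if $\gamma$ and $\tau$ have the same base clan (that is, they are in the same sect).
   Context: Everything is over $\mathbb{C}$. $\mathbf{B}_n$ is the group of upper triangular matrices in $\mathbf{SL}_n$; $\mathbf{P}_{p,q}$ is the group of matrices $\begin{bmatrix}x&h\\0&y\end{bmatrix}$ with $x\in\mathbf{GL}_p$, $y\in\mathbf{GL}_q$, $\det x\det y=1$, $h$ a $p\times q$ matrix; $\mathbf{L}_{p,q}\subset\mathbf{P}_{p,q}$ is the subgroup with $h=0$. $\mathbf{Fl}_n=\mathbf{SL}_n/\mathbf{B}_n$ is the variety of full flags in $\mathbb{C}^n$ ($g\mathbf{B}_n$ corresponds to the flag whose $i$-th subspace is the span of the first $i$ columns of $g$); $\langle v_1,\dots,v_n\rangle$ denotes the flag with $i$-th subspace $\mathrm{span}\{v_1,\dots,v_i\}$; $e_1,\dots,e_n$ is the standard basis. Clans. A $(p,q)$-clan is a sequence $\gamma=(c_1\dots c_n)$ in which each $c_i$ is $+$, $-$ or a natural number, each natural number that occurs does so exactly twice, and (number of $+$'s) $-$ (number of $-$'s) $=p-q$. Two such sequences that differ only by relabelling the natural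 numbers (same positions of matching pairs) are identified. The default signed clan of $\gamma$ assigns to each matching pair $c_i=c_j\in\mathbb{N}$, $i<j$, the signature $-$ at position $i$ and $+$ at position $j$. The base clan of $\gamma$ is obtained by replacing every natural number by its signature in the default signed clan. The sect of a base clan is the set of all clans having that base clan. Orbits. For a clan $\gamma$ with the default signatures, choose $\sigma\in S_n$ with $1\le\sigma(i)\le p$ if $c_i=+$ or $c_i$ is a number with signature $+$, and $p+1\le\sigma(i)\le n$ otherwise. Put $v_i=e_{\sigma(i)}$ if $c_i=\pm$; if $c_i=c_j\in\mathbb{N}$ ($i\ne j$), put $v_i=e_{\sigma(i)}+e_{\sigma(j)}$ if $c_i$ has signature $+$ and $v_i=-e_{\sigma(i)}+e_{\sigma(j)}$ if $c_i$ has signature $-$. Let $\mathbf{Q}_\gamma=\mathbf{L}_{p,q}\cdot\langle v_1,\dots,v_n\rangle\subset\mathbf{Fl}_n$ (independent of $\sigma$), and let $R_\gamma=\{g^{-1}\mathbf{L}_{p,q}: g\in\mathbf{SL}_n,\ g\mathbf{B}_n\in\mathbf{Q}_\gamma\}$, a $\mathbf{B}_n$-orbit in $\mathbf{SL}_n/\mathbf{L}_{p,q}$. It is known (Yamamoto) that $\gamma\mapsto \mathbf{Q}_\gamma$ is a bijection from the set of $(p,q)$-clans to the set of $\mathbf{L}_{p,q}$-orbits in $\mathbf{Fl}_n$, so $\gamma\mapsto R_\gamma$ is a bijection onto the set of $\mathbf{B}_n$-orbits in $\mathbf{SL}_n/\mathbf{L}_{p,q}$. *)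

theory Defs
  imports
    "HOL-Algebra.Coset"
    "HOL-Combinatorics.Permutations"
    "Jordan_Normal_Form.VS_Connect"
begin

section \<open>Groups and coset spaces\<close>

definition SL :: "nat \<Rightarrow> complex mat monoid" where
  "SL n = \<lparr>carrier = {A \<in> carrier_mat n n. det A = 1}, mult = (*), one = 1\<^sub>m n\<rparr>"

definition Bgrp :: "nat \<Rightarrow> complex mat set" where
  "Bgrp n = {A \<in> carrier (SL n). upper_triangular A}"

definition Pgrp :: "nat \<Rightarrow> nat \<Rightarrow> complex mat set" where
  "Pgrp p q = {four_block_mat x h (0\<^sub>m q p) y | x h y.
     x \<in> carrier_mat p p \<and> invertible_mat x \<and> y \<in> carrier_mat q q \<and> invertible_mat y \<and>
     h \<in> carrier_mat p q \<and> det x * det y = 1}"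

definition Lgrp :: "nat \<Rightarrow> nat \<Rightarrow> complex mat set" where
  "Lgrp p q = {four_block_mat x (0\<^sub>m p q) (0\<^sub>m q p) y | x y.
     x \<in> carrier_mat p p \<and> invertible_mat x \<and> y \<in> carrier_mat q q \<and> invertible_mat y \<and>
     det x * det y = 1}"

text \<open>On a left coset \<open>g L\<close> the set product with \<open>P\<close> is \<open>g P\<close>, because \<open>L\<close> is a subgroup of \<open>P\<close>
  (see \<open>proj_coset\<close> below).\<close>

definition proj :: "nat \<Rightarrow> nat \<Rightarrow> complex mat set \<Rightarrow> complex mat set" where
  "proj p q C = C <#>\<^bsub>SL (p + q)\<^esub> Pgrp p q"

abbreviation vspan :: "nat \<Rightarrow> complex vec set \<Rightarrow> complex vec set" where
  "vspan n S \<equiv> LinearCombinations.module.span class_ring (module_vec TYPE(complex) n) S"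

text \<open>The flag of a basis \<open>vs\<close>, as a point of \<open>SL\<^sub>n / B\<^sub>n\<close>: the set of all \<open>g\<close> in \<open>SL\<^sub>n\<close> whose first \<open>i\<close>
  columns span the same subspace as the first \<open>i\<close> vectors of \<open>vs\<close>, for every \<open>i\<close>.\<close>

definition flag :: "nat \<Rightarrow> complex vec list \<Rightarrow> complex mat set" where
  "flag n vs = {g \<in> carrier (SL n).
     \<forall>i \<in> {1..n}. vspan n (set (take i (cols g))) = vspan n (set (take i vs))}"

section \<open>Clans\<close>

datatype entry = Plus | Minus | Num nat

type_synonym clan = "entry list"

text \<open>Clans are represented by words; words differing only by the choice of the natural numbers
  (\<open>relabelling\<close>) denote the same clan. All positions and basis indices are counted from 0.\<close>

definition is_clan :: "nat \<Rightarrow> nat \<Rightarrow> clan \<Rightarrow> bool" where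
  "is_clan p q \<gamma> \<longleftrightarrow> length \<gamma> = p + q \<and>
     (\<forall>k. Num k \<in> set \<gamma> \<longrightarrow> count_list \<gamma> (Num k) = 2) \<and>
     int (count_list \<gamma> Plus) - int (count_list \<gamma> Minus) = int p - int q"

definition relabelling :: "clan \<Rightarrow> clan \<Rightarrow> bool" where
  "relabelling \<gamma> \<delta> \<longleftrightarrow> length \<gamma> = length \<delta> \<and>
     (\<forall>i<length \<gamma>. (\<gamma> ! i = Plus \<longleftrightarrow> \<delta> ! i = Plus) \<and> (\<gamma> ! i = Minus \<longleftrightarrow> \<delta> ! i = Minus)) \<and>
     (\<forall>i<length \<gamma>. \<forall>j<length \<gamma>. \<gamma> ! i = \<gamma> ! j \<longleftrightarrow> \<delta> ! i = \<delta> ! j)"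

definition mate :: "clan \<Rightarrow> nat \<Rightarrow> nat" where
  "mate \<gamma> i = (THE j. j < length \<gamma> \<and> j \<noteq> i \<and> \<gamma> ! j = \<gamma> ! i)"

text \<open>The sign at a position, natural numbers being replaced by their default signature.\<close>

definition signature :: "clan \<Rightarrow> nat \<Rightarrow> entry" where
  "signature \<gamma> i =
     (case \<gamma> ! i of Num k \<Rightarrow> (if i < mate \<gamma> i then Minus else Plus) | s \<Rightarrow> s)"

definition base_clan :: "clan \<Rightarrow> clan" where
  "base_clan \<gamma> = map (signature \<gamma>) [0..<length \<gamma>]"

section \<open>Orbits\<close>

definition admissible :: "nat \<Rightarrow> nat \<Rightarrow> clan \<Rightarrow> (nat \<Rightarrow> nat) \<Rightarrow> bool" where
  "admissible p q \<gamma> \<sigma> \<longleftrightarrow> \<sigma> permutes {0..<p + q} \<and>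
     (\<forall>i<p + q. \<sigma> i \<in> (if signature \<gamma> i = Plus then {0..<p} else {p..<p + q}))"

definition clan_vec :: "clan \<Rightarrow> (nat \<Rightarrow> nat) \<Rightarrow> nat \<Rightarrow> complex vec" where
  "clan_vec \<gamma> \<sigma> i = (let n = length \<gamma> in
     case \<gamma> ! i of
       Num k \<Rightarrow> (if signature \<gamma> i = Plus
                 then unit_vec n (\<sigma> i) + unit_vec n (\<sigma> (mate \<gamma> i))
                 else - unit_vec n (\<sigma> i) + unit_vec n (\<sigma> (mate \<gamma> i)))
     | _ \<Rightarrow> unit_vec n (\<sigma> i))"

definition clan_flag :: "clan \<Rightarrow> (nat \<Rightarrow> nat) \<Rightarrow> complex mat set" where
  "clan_flag \<gamma> \<sigma> = flag (length \<gamma>) (map (clan_vec \<gamma> \<sigma>) [0..<length \<gamma>])"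

definition Q_orbit :: "nat \<Rightarrow> nat \<Rightarrow> clan \<Rightarrow> (nat \<Rightarrow> nat) \<Rightarrow> complex mat set set" where
  "Q_orbit p q \<gamma> \<sigma> = {l <#\<^bsub>SL (p + q)\<^esub> clan_flag \<gamma> \<sigma> | l. l \<in> Lgrp p q}"

definition R_orbit :: "nat \<Rightarrow> nat \<Rightarrow> clan \<Rightarrow> (nat \<Rightarrow> nat) \<Rightarrow> complex mat set set" where
  "R_orbit p q \<gamma> \<sigma> = {inv\<^bsub>SL (p + q)\<^esub> g <#\<^bsub>SL (p + q)\<^esub> Lgrp p q | g.
     g \<in> carrier (SL (p + q)) \<and> g <#\<^bsub>SL (p + q)\<^esub> Bgrp (p + q) \<in> Q_orbit p q \<gamma> \<sigma>}"

section \<open>Consistency of the encoding\<close>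

lemma group_SL: "group (SL n)"
proof (rule groupI)
  fix x assume x: "x \<in> carrier (SL n)"
  then have xc: "x \<in> carrier_mat n n" and d: "det x = 1" by (auto simp: SL_def)
  from adj_mat[OF xc] d have a: "adj_mat x \<in> carrier_mat n n" "adj_mat x * x = 1\<^sub>m n" by auto
  have "det (adj_mat x) * det x = 1" using det_mult[OF a(1) xc] a(2) by simp
  with a d show "\<exists>y\<in>carrier (SL n). y \<otimes>\<^bsub>SL n\<^esub> x = \<one>\<^bsub>SL n\<^esub>"
    by (intro bexI[of _ "adj_mat x"]) (auto simp: SL_def)
qed (auto simp: SL_def det_mult assoc_mult_mat)

lemma Pgrp_subset: "Pgrp p q \<subseteq> carrier (SL (p + q))"
  by (auto simp: Pgrp_def SL_def intro!: four_block_carrier_mat)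
     (subst det_four_block_mat_lower_left_zero, auto)

lemma Lgrp_subset_Pgrp: "Lgrp p q \<subseteq> Pgrp p q"
  unfolding Lgrp_def Pgrp_def by (smt (verit) Collect_mono zero_carrier_mat)

lemma relabelling_mate:
  assumes "relabelling \<gamma> \<delta>" "i < length \<gamma>" shows "mate \<gamma> i = mate \<delta> i"
  using assms unfolding mate_def relabelling_def by (metis (no_types, lifting))

lemma relabelling_signature:
  assumes r: "relabelling \<gamma> \<delta>" and i: "i < length \<gamma>" shows "signature \<gamma> i = signature \<delta> i"
  using relabelling_mate[OF r i] r i unfolding signature_def relabelling_def
  by (auto split: entry.splits)

lemma relabelling_base_clan: "relabelling \<gamma> \<delta> \<Longrightarrow> base_clan \<gamma> = base_clan \<delta>"
  using relabelling_signature by (auto simp: base_clan_def relabelling_def)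

lemma relabelling_clan_vec:
  assumes r: "relabelling \<gamma> \<delta>" and i: "i < length \<gamma>" shows "clan_vec \<gamma> \<sigma> i = clan_vec \<delta> \<sigma> i"
  using relabelling_mate[OF r i] relabelling_signature[OF r i] r i
  unfolding clan_vec_def relabelling_def Let_def by (auto split: entry.splits)

lemma relabelling_R_orbit:
  assumes "relabelling \<gamma> \<delta>" shows "R_orbit p q \<gamma> \<sigma> = R_orbit p q \<delta> \<sigma>"
proof -
  have "length \<gamma> = length \<delta>" using assms by (simp add: relabelling_def)
  with relabelling_clan_vec[OF assms] have "clan_flag \<gamma> \<sigma> = clan_flag \<delta> \<sigma>"
    unfolding clan_flag_def by (auto intro!: arg_cong2[of _ _ _ _ flag])
  then show ?thesis by (simp add: R_orbit_def Q_orbit_def)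
qed

lemma invertible_mat_det:
  fixes A :: "complex mat"
  assumes A: "A \<in> carrier_mat n n" and d: "det A \<noteq> 0" shows "invertible_mat A"
proof -
  define B where "B = inverse (det A) \<cdot>\<^sub>m adj_mat A"
  have B: "B \<in> carrier_mat n n" using adj_mat(1)[OF A] by (simp add: B_def)
  have "A * B = 1\<^sub>m n" "B * A = 1\<^sub>m n"
    unfolding B_def using adj_mat[OF A] A d
    by (auto simp: mult_smult_distrib mult_smult_assoc_mat intro!: eq_matI)
  then show ?thesis using A B unfolding invertible_mat_def inverts_mat_def by auto
qed

lemma one_in_Lgrp: "1\<^sub>m (p + q) \<in> Lgrp p q"
proof -
  have "1\<^sub>m (p + q) = four_block_mat (1\<^sub>m p) (0\<^sub>m p q) (0\<^sub>m q p) (1\<^sub>m q :: complex mat)"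
    by simp
  moreover have "invertible_mat (1\<^sub>m p :: complex mat)" "invertible_mat (1\<^sub>m q :: complex mat)"
    by (auto intro!: invertible_mat_det)
  ultimately show ?thesis unfolding Lgrp_def
    by (intro CollectI exI[of _ "1\<^sub>m p"] exI[of _ "1\<^sub>m q"]) simp
qed

lemma Pgrp_mult:
  assumes "a \<in> Pgrp p q" "b \<in> Pgrp p q" shows "a * b \<in> Pgrp p q"
proof -
  obtain x h y where a: "a = four_block_mat x h (0\<^sub>m q p) y" "x \<in> carrier_mat p p"
    "invertible_mat x" "y \<in> carrier_mat q q" "invertible_mat y" "h \<in> carrier_mat p q"
    "det x * det y = 1"
    using assms(1) by (auto simp: Pgrp_def)
  obtain x' h' y' where b: "b = four_block_mat x' h' (0\<^sub>m q p) y'" "x' \<in> carrier_mat p p"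
    "invertible_mat x'" "y' \<in> carrier_mat q q" "invertible_mat y'" "h' \<in> carrier_mat p q"
    "det x' * det y' = 1"
    using assms(2) by (auto simp: Pgrp_def)
  have "a * b = four_block_mat (x * x') (x * h' + h * y') (0\<^sub>m q p) (y * y')"
    unfolding a(1) b(1) using a b by (subst mult_four_block_mat) auto
  moreover have det: "det (x * x') * det (y * y') = 1"
  proof -
    have "det (x * x') * det (y * y') = (det x * det y) * (det x' * det y')"
      using det_mult[OF a(2) b(2)] det_mult[OF a(4) b(4)] by (simp only: mult_ac)
    then show ?thesis using a b by simp
  qed
  moreover have "invertible_mat (x * x')" "invertible_mat (y * y')"
    using a b det by (auto intro!: invertible_mat_det)
  ultimately show ?thesis using a b unfolding Pgrp_def
    by (intro CollectI exI[of _ "x * x'"] exI[of _ "x * h' + h * y'"] exI[of _ "y * y'"]) simp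
qed

lemma proj_coset:
  assumes g: "g \<in> carrier (SL (p + q))"
  shows "proj p q (g <#\<^bsub>SL (p + q)\<^esub> Lgrp p q) = g <#\<^bsub>SL (p + q)\<^esub> Pgrp p q"
proof -
  interpret group "SL (p + q)" by (rule group_SL)
  have LS: "Lgrp p q \<subseteq> carrier (SL (p + q))" using Lgrp_subset_Pgrp Pgrp_subset by blast
  have m: "x \<otimes>\<^bsub>SL (p + q)\<^esub> y = x * y" for x y by (simp add: SL_def)
  have one: "\<one>\<^bsub>SL (p + q)\<^esub> = 1\<^sub>m (p + q)" by (simp add: SL_def)
  have "Lgrp p q <#>\<^bsub>SL (p + q)\<^esub> Pgrp p q = Pgrp p q"
  proof
    show "Lgrp p q <#>\<^bsub>SL (p + q)\<^esub> Pgrp p q \<subseteq> Pgrp p q"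
      using Pgrp_mult Lgrp_subset_Pgrp by (fastforce simp: set_mult_def m)
    show "Pgrp p q \<subseteq> Lgrp p q <#>\<^bsub>SL (p + q)\<^esub> Pgrp p q"
    proof
      fix x assume x: "x \<in> Pgrp p q"
      then have "\<one>\<^bsub>SL (p + q)\<^esub> \<otimes>\<^bsub>SL (p + q)\<^esub> x = x" using Pgrp_subset by (intro l_one) blast
      with x one_in_Lgrp show "x \<in> Lgrp p q <#>\<^bsub>SL (p + q)\<^esub> Pgrp p q"
        unfolding set_mult_def one by force
    qed
  qed
  then show ?thesis
    using set_mult_assoc[of "{g}" "Lgrp p q" "Pgrp p q"] g LS Pgrp_subset
    by (simp add: proj_def l_coset_eq_set_mult)
qed

lemma count_list_card: "count_list xs y = card {i. i < length xs \<and> xs ! i = y}"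
  unfolding count_list_eq_length_filter length_filter_conv_card
  by (rule arg_cong[where f = card]) auto

lemma mate:
  assumes c: "is_clan p q \<gamma>" and i: "i < p + q" and k: "\<gamma> ! i = Num k"
  shows "mate \<gamma> i < p + q" "mate \<gamma> i \<noteq> i" "\<gamma> ! mate \<gamma> i = Num k" "mate \<gamma> (mate \<gamma> i) = i"
proof -
  have len: "length \<gamma> = p + q" using c by (simp add: is_clan_def)
  have "Num k \<in> set \<gamma>" using i k len by (metis nth_mem)
  then have "card {j. j < length \<gamma> \<and> \<gamma> ! j = Num k} = 2"
    using c unfolding is_clan_def count_list_card by blast
  then obtain a b where ab: "{j. j < length \<gamma> \<and> \<gamma> ! j = Num k} = {a, b}" "a \<noteq> b"
    by (auto simp: card_2_iff)
  then have iff: "\<And>j. j < length \<gamma> \<and> \<gamma> ! j = Num k \<longleftrightarrow> j = a \<or> j = b" by blast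
  have ma: "mate \<gamma> a = b" and mb: "mate \<gamma> b = a"
    unfolding mate_def using ab(2) iff by (metis (mono_tags, lifting) the_equality)+
  show "mate \<gamma> i < p + q" "mate \<gamma> i \<noteq> i" "\<gamma> ! mate \<gamma> i = Num k" "mate \<gamma> (mate \<gamma> i) = i"
    using ma mb ab(2) iff i k len by metis+
qed

lemma card_signature_Plus:
  assumes c: "is_clan p q \<gamma>" shows "card {i. i < p + q \<and> signature \<gamma> i = Plus} = p"
proof -
  have len: "length \<gamma> = p + q" using c by (simp add: is_clan_def)
  define N where "N = {i. i < p + q \<and> (\<exists>k. \<gamma> ! i = Num k)}"
  define F where "F = {i \<in> N. i < mate \<gamma> i}"
  define S where "S = {i \<in> N. mate \<gamma> i < i}"
  define P where "P = {i. i < p + q \<and> \<gamma> ! i = Plus}"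
  define M where "M = {i. i < p + q \<and> \<gamma> ! i = Minus}"
  have fin: "finite N" "finite F" "finite S" "finite P" "finite M"
    by (auto simp: N_def F_def S_def P_def M_def)
  have "bij_betw (mate \<gamma>) F S"
    by (rule bij_betw_byWitness[where f' = "mate \<gamma>"]) (auto simp: F_def S_def N_def mate[OF c])
  then have FS: "card F = card S" by (rule bij_betw_same_card)
  have NFS: "N = F \<union> S" unfolding F_def S_def using mate(2)[OF c] by (fastforce simp: N_def)
  have cN: "card N = card F + card S" unfolding NFS
    by (rule card_Un_disjoint) (use fin in \<open>auto simp: F_def S_def\<close>)
  have all: "{..<p + q} = P \<union> M \<union> N" by (auto simp: P_def M_def N_def) (metis entry.exhaust)
  have "p + q = card (P \<union> M \<union> N)" unfolding all[symmetric] by simp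
  also have "\<dots> = card P + card M + card N"
    by (subst card_Un_disjoint; (use fin in \<open>auto simp: P_def M_def N_def\<close>)?)
       (subst card_Un_disjoint, auto)
  finally have tot: "p + q = card P + card M + card N" .
  have dif: "int (card P) - int (card M) = int p - int q"
    using c len by (simp add: is_clan_def count_list_card P_def M_def)
  have sig: "{i. i < p + q \<and> signature \<gamma> i = Plus} = P \<union> S"
  proof (intro Set.set_eqI)
    fix i
    show "i \<in> {i. i < p + q \<and> signature \<gamma> i = Plus} \<longleftrightarrow> i \<in> P \<union> S"
      using mate(2)[OF c, of i]
      by (cases "\<gamma> ! i") (auto simp: signature_def P_def S_def N_def)
  qed
  have "card (P \<union> S) = card P + card S"
    by (rule card_Un_disjoint) (use fin in \<open>auto simp: P_def S_def N_def\<close>)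
  then show ?thesis unfolding sig using tot dif cN FS by linarith
qed

lemma admissible_exists:
  assumes c: "is_clan p q \<gamma>" shows "\<exists>\<sigma>. admissible p q \<gamma> \<sigma>"
proof -
  define A where "A = {i. i < p + q \<and> signature \<gamma> i = Plus}"
  define B where "B = {i. i < p + q \<and> signature \<gamma> i \<noteq> Plus}"
  have fin: "finite A" "finite B" and AB: "A \<union> B = {0..<p + q}" "A \<inter> B = {}"
    by (auto simp: A_def B_def)
  have cA: "card A = p" using card_signature_Plus[OF c] by (simp add: A_def)
  have "card (A \<union> B) = card A + card B" using fin AB(2) by (rule card_Un_disjoint)
  then have cB: "card B = q" using cA AB by simp
  obtain f where f: "bij_betw f A {0..<p}"
    using finite_same_card_bij[of A "{0..<p}"] fin cA by auto
  obtain g where g: "bij_betw g B {p..<p + q}"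
    using finite_same_card_bij[of B "{p..<p + q}"] fin cB by auto
  define \<sigma> where "\<sigma> i = (if i \<in> A then f i else if i \<in> B then g i else i)" for i
  have sA: "bij_betw \<sigma> A {0..<p}"
    using f by (rule bij_betw_cong[THEN iffD1, rotated]) (simp add: \<sigma>_def)
  have sB: "bij_betw \<sigma> B {p..<p + q}"
    using g by (rule bij_betw_cong[THEN iffD1, rotated]) (use AB in \<open>auto simp: \<sigma>_def\<close>)
  have "bij_betw \<sigma> (A \<union> B) ({0..<p} \<union> {p..<p + q})"
    by (rule bij_betw_combine[OF sA sB]) auto
  then have "bij_betw \<sigma> {0..<p + q} {0..<p + q}"
    unfolding AB by (simp add: ivl_disj_un_two)
  then have "\<sigma> permutes {0..<p + q}"
    by (rule bij_imp_permutes) (use AB in \<open>auto simp: \<sigma>_def\<close>)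
  moreover have "\<sigma> i \<in> (if signature \<gamma> i = Plus then {0..<p} else {p..<p + q})" if "i < p + q" for i
    using bij_betwE[OF sA] bij_betwE[OF sB] that by (auto simp: A_def B_def)
  ultimately show ?thesis unfolding admissible_def by blast
qed

end

theory Submission
  imports Defs
begin

text \<open>The image of \<open>R\<^sub>\<gamma>\<close> is determined by the double coset \<open>P V B\<close> of a matrix \<open>V\<close> whose columns span the
  flag of \<open>\<gamma>\<close>. One multiplication by an upper triangular matrix and one by a parabolic matrix turn
  \<open>V\<close> into the permutation matrix of \<open>\<sigma>\<close>, so the matching of the clan disappears and only the signs
  remain. The signs can be recovered: the sign at \<open>i\<close> is \<open>+\<close> iff the \<open>i\<close>-th subspace of the flag
  contains a vector of the span of the first \<open>p\<close> unit vectors that is not in the previous subspace, and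
  this condition is invariant under both groups.\<close>

section \<open>Roots of complex numbers and inverse matrices\<close>

text \<open>The set of roots has non-zero cardinality, so it is inhabited. The roots serve as
  scalars that bring determinants to 1, since
  \<open>det (z \<cdot>\<^sub>m M) = z ^ n * det M\<close>.\<close>

lemma complex_nth_root_exists:
  fixes c :: complex
  assumes "n > 0" "c \<noteq> 0" obtains z where "z ^ n = c" "z \<noteq> 0"
proof -
  have "card {z. z ^ n = c} \<noteq> 0" using card_nth_roots[OF assms(2,1)] assms by simp
  then obtain z where "z ^ n = c" by (metis (mono_tags) card.empty ex_in_conv mem_Collect_eq)
  with that assms show ?thesis by (metis zero_power)
qed

lemma mat_inverse_obtain:
  fixes A :: "'a :: field mat"
  assumes "A \<in> carrier_mat n n" "det A \<noteq> 0"
  obtains B where "B \<in> carrier_mat n n" "B * A = 1\<^sub>m n" "A * B = 1\<^sub>m n" "det B \<noteq> 0"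
proof -
  define B where "B = inverse (det A) \<cdot>\<^sub>m adj_mat A"
  have B: "B \<in> carrier_mat n n" using adj_mat(1)[OF assms(1)] by (simp add: B_def)
  have BA: "B * A = 1\<^sub>m n"
    unfolding B_def using adj_mat[OF assms(1)] assms
    by (auto simp: mult_smult_assoc_mat intro!: eq_matI)
  have "det B * det A = 1" using det_mult[OF B assms(1)] BA by simp
  then have "det B \<noteq> 0" by auto
  with that[OF B BA mat_mult_left_right_inverse[OF B assms(1) BA]] show ?thesis by blast
qed

subsection \<open>Upper triangular and block upper triangular matrices\<close>

text \<open>The Borel subgroup of GL_n instead of SL_n: a matrix of clan vectors need not have
  determinant 1, so determinants are left free until cosets in SL_n are compared.\<close>

definition invertible_triangular :: "nat \<Rightarrow> 'a :: field mat set" where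
  "invertible_triangular n = {b \<in> carrier_mat n n. det b \<noteq> 0 \<and> upper_triangular b}"

text \<open>The counterpart of \<open>Pgrp\<close> in GL_n. The zero block is described entry by
  entry, which suits products, permutation matrices and matrix-vector products.\<close>

definition parabolic :: "nat \<Rightarrow> nat \<Rightarrow> 'a :: field mat set" where
  "parabolic p q = {x \<in> carrier_mat (p + q) (p + q). det x \<noteq> 0 \<and>
     (\<forall>i j. p \<le> i \<longrightarrow> i < p + q \<longrightarrow> j < p \<longrightarrow> x $$ (i, j) = 0)}"

lemma invertible_triangular_mult:
  assumes a: "a \<in> invertible_triangular n" and b: "b \<in> invertible_triangular n"
  shows "a * b \<in> invertible_triangular n"
proof -
  have c: "a \<in> carrier_mat n n" "b \<in> carrier_mat n n" and d: "det a \<noteq> 0" "det b \<noteq> 0"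
    and u: "upper_triangular a" "upper_triangular b"
    using assms by (auto simp: invertible_triangular_def)
  have "(a * b) $$ (i, j) = 0" if "j < i" "i < n" for i j
  proof -
    have "a $$ (i, k) * b $$ (k, j) = 0" if "k < n" for k
      using upper_triangularD[OF u(1), of k i] upper_triangularD[OF u(2), of j k] c that
        \<open>j < i\<close> \<open>i < n\<close> by (cases "k < i") auto
    then show ?thesis using c that by (auto simp: scalar_prod_def intro!: sum.neutral)
  qed
  then have "upper_triangular (a * b)" using c by (intro upper_triangularI) auto
  then show ?thesis using c d by (auto simp: invertible_triangular_def det_mult[OF c])
qed

text \<open>Strong induction on the column \<open>j\<close> below the diagonal of \<open>c\<close>.
  In entry \<open>(i, j)\<close> of \<open>c * b\<close> the terms with \<open>k < j\<close> vanish
  by induction and those with \<open>k > j\<close> because \<open>b\<close> is triangular. What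
  remains is \<open>c $$ (i, j) * b $$ (j, j) = 0\<close>, and the diagonal of \<open>b\<close> has
  no zero.\<close>

lemma upper_triangular_left_inverse:
  fixes b c :: "'a :: field mat"
  assumes b: "b \<in> invertible_triangular n" and c: "c \<in> carrier_mat n n" and cb: "c * b = 1\<^sub>m n"
  shows "upper_triangular c"
proof (rule upper_triangularI)
  have bc: "b \<in> carrier_mat n n" and d: "det b \<noteq> 0" and u: "upper_triangular b"
    using b by (auto simp: invertible_triangular_def)
  fix i j assume "j < i" "i < dim_row c"
  then show "c $$ (i, j) = 0"
  proof (induction j rule: less_induct)
    case (less j)
    have ij: "j < i" "i < n" using less.prems c by auto
    have "0 = (c * b) $$ (i, j)" using cb ij by simp
    also have "\<dots> = (\<Sum>k<n. c $$ (i, k) * b $$ (k, j))"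
      using c bc ij by (auto simp: scalar_prod_def atLeast0LessThan)
    also have "\<dots> = (\<Sum>k\<in>{j}. c $$ (i, k) * b $$ (k, j))"
    proof (rule sum.mono_neutral_right)
      show "\<forall>k\<in>{..<n} - {j}. c $$ (i, k) * b $$ (k, j) = 0"
      proof
        fix k assume k: "k \<in> {..<n} - {j}"
        show "c $$ (i, k) * b $$ (k, j) = 0"
        proof (cases "k < j")
          case True
          then show ?thesis using less.IH[of k] ij c by simp
        next
          case False
          then show ?thesis using upper_triangularD[OF u, of j k] k bc by simp
        qed
      qed
    qed (use ij in auto)
    finally have "c $$ (i, j) * b $$ (j, j) = 0" by simp
    moreover have "b $$ (j, j) \<noteq> 0"
      using upper_triangular_imp_det_eq_0_iff[OF bc u] d bc ij by (auto simp: diag_mat_def)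
    ultimately show ?case by simp
  qed
qed

lemma invertible_triangular_inverse:
  assumes b: "b \<in> invertible_triangular n"
  obtains c where "c \<in> invertible_triangular n" "c * b = 1\<^sub>m n" "b * c = 1\<^sub>m n"
proof -
  have "b \<in> carrier_mat n n" "det b \<noteq> 0" using b by (auto simp: invertible_triangular_def)
  then obtain c where c: "c \<in> carrier_mat n n" "c * b = 1\<^sub>m n" "b * c = 1\<^sub>m n" "det c \<noteq> 0"
    by (rule mat_inverse_obtain)
  with upper_triangular_left_inverse[OF b c(1,2)] that show ?thesis
    by (auto simp: invertible_triangular_def)
qed

lemma parabolic_mult:
  assumes a: "a \<in> parabolic p q" and b: "b \<in> parabolic p q"
  shows "a * b \<in> parabolic p q"
proof -
  have c: "a \<in> carrier_mat (p + q) (p + q)" "b \<in> carrier_mat (p + q) (p + q)"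
    and d: "det a \<noteq> 0" "det b \<noteq> 0"
    and z: "\<And>i j. p \<le> i \<Longrightarrow> i < p + q \<Longrightarrow> j < p \<Longrightarrow> a $$ (i, j) = 0 \<and> b $$ (i, j) = 0"
    using assms by (auto simp: parabolic_def)
  have "(a * b) $$ (i, j) = 0" if ij: "p \<le> i" "i < p + q" "j < p" for i j
  proof -
    have "a $$ (i, k) * b $$ (k, j) = 0" if "k < p + q" for k
      using z[of i k] z[of k j] ij that by (cases "k < p") auto
    then show ?thesis using c ij by (auto simp: scalar_prod_def intro!: sum.neutral)
  qed
  then show ?thesis using c d by (auto simp: parabolic_def det_mult[OF c])
qed

text \<open>Passes from the entrywise description to the block form of \<open>Pgrp\<close>; the
  determinant is the product over the diagonal blocks, so both blocks are invertible.\<close>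

lemma parabolic_blocks:
  assumes a: "a \<in> parabolic p q"
  obtains x h y where "a = four_block_mat x h (0\<^sub>m q p) y" "x \<in> carrier_mat p p"
    "h \<in> carrier_mat p q" "y \<in> carrier_mat q q" "det x \<noteq> 0" "det y \<noteq> 0" "det a = det x * det y"
proof -
  have ac: "a \<in> carrier_mat (p + q) (p + q)" and d: "det a \<noteq> 0"
    and z: "\<And>i j. p \<le> i \<Longrightarrow> i < p + q \<Longrightarrow> j < p \<Longrightarrow> a $$ (i, j) = 0"
    using a by (auto simp: parabolic_def)
  obtain x h w y where s: "split_block a p p = (x, h, w, y)" by (cases "split_block a p p")
  note b = split_block[OF s, of q q]
  have "w = 0\<^sub>m q p"
    using s ac z unfolding split_block_def Let_def by (auto intro!: eq_matI)
  then have eq: "a = four_block_mat x h (0\<^sub>m q p) y" and c: "x \<in> carrier_mat p p"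
    "h \<in> carrier_mat p q" "y \<in> carrier_mat q q" using b ac by auto
  have dd: "det a = det x * det y"
    unfolding eq by (rule det_four_block_mat_lower_left_zero[OF c(1,2) refl c(3)])
  with that[OF eq c] d show ?thesis by auto
qed

text \<open>If \<open>c\<close> inverts \<open>a\<close>, the lower left block of
  \<open>c * a = 1\<close> is \<open>c3 * x = 0\<close>. The diagonal block \<open>x\<close> is
  itself invertible, and cancelling it gives \<open>c3 = 0\<close>.\<close>

lemma parabolic_inverse:
  assumes a: "a \<in> parabolic p q"
  obtains c where "c \<in> parabolic p q" "c * a = 1\<^sub>m (p + q)" "a * c = 1\<^sub>m (p + q)"
proof -
  have "a \<in> carrier_mat (p + q) (p + q)" "det a \<noteq> 0" using a by (auto simp: parabolic_def)
  then obtain c where c: "c \<in> carrier_mat (p + q) (p + q)" "c * a = 1\<^sub>m (p + q)"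
    "a * c = 1\<^sub>m (p + q)" "det c \<noteq> 0" by (rule mat_inverse_obtain)
  obtain x h y where b: "a = four_block_mat x h (0\<^sub>m q p) y" "x \<in> carrier_mat p p"
    "h \<in> carrier_mat p q" "y \<in> carrier_mat q q" "det x \<noteq> 0" "det y \<noteq> 0"
    using parabolic_blocks[OF a] by metis
  obtain c1 c2 c3 c4 where s: "split_block c p p = (c1, c2, c3, c4)" by (cases "split_block c p p")
  note sb = split_block[OF s, of q q]
  have cc: "c1 \<in> carrier_mat p p" "c2 \<in> carrier_mat p q" "c3 \<in> carrier_mat q p"
    "c4 \<in> carrier_mat q q" and ceq: "c = four_block_mat c1 c2 c3 c4" using sb c(1) by auto
  have prod: "c * a = four_block_mat (c1 * x + c2 * 0\<^sub>m q p) (c1 * h + c2 * y)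
      (c3 * x + c4 * 0\<^sub>m q p) (c3 * h + c4 * y)"
    unfolding ceq b(1) by (rule mult_four_block_mat[OF cc b(2,3) _ b(4)]) simp
  have "c3 * x = 0\<^sub>m q p"
  proof (rule eq_matI)
    fix i j assume "i < dim_row (0\<^sub>m q p :: 'a mat)" "j < dim_col (0\<^sub>m q p :: 'a mat)"
    then have ij: "i < q" "j < p" by auto
    have "(c * a) $$ (p + i, j) = (c3 * x) $$ (i, j)"
      unfolding prod using cc b ij by (subst index_mat_four_block) auto
    then show "(c3 * x) $$ (i, j) = 0\<^sub>m q p $$ (i, j)" using c(2) ij by simp
  qed (use cc b in auto)
  obtain x' where x': "x' \<in> carrier_mat p p" "x * x' = 1\<^sub>m p"
    using mat_inverse_obtain[OF b(2,5)] by metis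
  have "c3 = c3 * (x * x')" using x' cc by simp
  also have "\<dots> = c3 * x * x'" using assoc_mult_mat[OF cc(3) b(2) x'(1)] by simp
  also have "\<dots> = 0\<^sub>m q p" using \<open>c3 * x = 0\<^sub>m q p\<close> x' by simp
  finally have c3: "c3 = 0\<^sub>m q p" .
  have "c $$ (i, j) = 0" if "p \<le> i" "i < p + q" "j < p" for i j
    unfolding ceq using c3 cc that by (subst index_mat_four_block) auto
  with c that show ?thesis by (auto simp: parabolic_def)
qed

lemma smult_invertible_triangular:
  assumes "a \<in> invertible_triangular n" "c \<noteq> 0"
  shows "c \<cdot>\<^sub>m a \<in> invertible_triangular n"
proof -
  have a: "a \<in> carrier_mat n n" "upper_triangular a" "det a \<noteq> 0"
    using assms(1) by (auto simp: invertible_triangular_def)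
  have "upper_triangular (c \<cdot>\<^sub>m a)"
    by (rule upper_triangularI) (use a(1) upper_triangularD[OF a(2)] in auto)
  then show ?thesis using a assms(2) by (simp add: invertible_triangular_def)
qed

lemma smult_parabolic:
  "a \<in> parabolic p q \<Longrightarrow> c \<noteq> 0 \<Longrightarrow> c \<cdot>\<^sub>m a \<in> parabolic p q"
  by (auto simp: parabolic_def)

lemma Pgrp_iff_parabolic: "x \<in> Pgrp p q \<longleftrightarrow> x \<in> parabolic p q \<and> det x = 1"
proof
  assume x: "x \<in> Pgrp p q"
  then have "x \<in> carrier (SL (p + q))" using Pgrp_subset by blast
  then have "x \<in> carrier_mat (p + q) (p + q)" "det x = 1" by (auto simp: SL_def)
  with x show "x \<in> parabolic p q \<and> det x = 1" by (auto simp: Pgrp_def parabolic_def)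
next
  assume x: "x \<in> parabolic p q \<and> det x = 1"
  then obtain a h y where b: "x = four_block_mat a h (0\<^sub>m q p) y" "a \<in> carrier_mat p p"
    "h \<in> carrier_mat p q" "y \<in> carrier_mat q q" "det a \<noteq> 0" "det y \<noteq> 0" "det x = det a * det y"
    using parabolic_blocks by metis
  then show "x \<in> Pgrp p q" unfolding Pgrp_def
    using x invertible_mat_det[OF b(2,5)] invertible_mat_det[OF b(4,6)] by auto
qed

subsection \<open>Flags\<close>

text \<open>A linear combination of columns is the matrix applied to the coefficient vector; using
  only the first \<open>i\<close> columns means padding that vector by zeros. Membership in a step
  of a flag thus becomes a condition on coordinates.\<close>

lemma in_vspan_take_cols_iff:
  assumes A: "A \<in> carrier_mat n n" and i: "i \<le> n"
  shows "v \<in> vspan n (set (take i (cols A))) \<longleftrightarrow>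
    (\<exists>c\<in>carrier_vec n. (\<forall>k<n. i \<le> k \<longrightarrow> c $ k = 0) \<and> v = A *\<^sub>v c)"
proof -
  interpret vec_space "TYPE(complex)" n .
  let ?ws = "take i (cols A)"
  have ws: "set ?ws \<subseteq> carrier_vec n" using cols_dim[of A] A set_take_subset[of i "cols A"] by auto
  have len: "length ?ws = i" using A i by simp
  have lc: "lincomb_list f ?ws = A *\<^sub>v vec n (\<lambda>k. if k < i then f k else 0)" for f
  proof -
    have "lincomb_list f ?ws = mat_of_cols n ?ws *\<^sub>v vec i f"
      using lincomb_list_as_mat_mult[of ?ws f] ws len carrier_vecD by (metis subsetD)
    also have "\<dots> = A *\<^sub>v vec n (\<lambda>k. if k < i then f k else 0)"
    proof (rule eq_vecI)
      fix r assume "r < dim_vec (A *\<^sub>v vec n (\<lambda>k. if k < i then f k else 0))"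
      then have r: "r < n" using A by simp
      have "(mat_of_cols n ?ws *\<^sub>v vec i f) $ r = (\<Sum>k<i. A $$ (r, k) * f k)"
        using r len A i by (auto simp: scalar_prod_def mat_of_cols_index atLeast0LessThan intro!: sum.cong)
      also have "\<dots> = (\<Sum>k<n. A $$ (r, k) * (if k < i then f k else 0))"
        using i by (intro sum.mono_neutral_cong_left) auto
      also have "\<dots> = (A *\<^sub>v vec n (\<lambda>k. if k < i then f k else 0)) $ r"
        using r A by (auto simp: scalar_prod_def atLeast0LessThan intro!: sum.cong)
      finally show "(mat_of_cols n ?ws *\<^sub>v vec i f) $ r = \<dots>" .
    qed (use A in auto)
    finally show ?thesis .
  qed
  \<comment> \<open>The span is that of a set, in which repeated columns coincide; the span of the
    list gives every position its own coefficient.\<close>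
  have "v \<in> vspan n (set ?ws) \<longleftrightarrow> (\<exists>f. v = lincomb_list f ?ws)"
    using span_list_as_span[OF ws] by (auto simp: span_list_def)
  also have "\<dots> \<longleftrightarrow> (\<exists>c\<in>carrier_vec n. (\<forall>k<n. i \<le> k \<longrightarrow> c $ k = 0) \<and> v = A *\<^sub>v c)"
  proof
    assume "\<exists>f. v = lincomb_list f ?ws"
    then obtain f where "v = A *\<^sub>v vec n (\<lambda>k. if k < i then f k else 0)" using lc by auto
    then show "\<exists>c\<in>carrier_vec n. (\<forall>k<n. i \<le> k \<longrightarrow> c $ k = 0) \<and> v = A *\<^sub>v c"
      by (intro bexI[of _ "vec n (\<lambda>k. if k < i then f k else 0)"]) auto
  next
    assume "\<exists>c\<in>carrier_vec n. (\<forall>k<n. i \<le> k \<longrightarrow> c $ k = 0) \<and> v = A *\<^sub>v c"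
    then obtain c where c: "c \<in> carrier_vec n" "\<forall>k<n. i \<le> k \<longrightarrow> c $ k = 0" "v = A *\<^sub>v c" by auto
    have "vec n (\<lambda>k. if k < i then c $ k else 0) = c" using c by (intro eq_vecI) auto
    then show "\<exists>f. v = lincomb_list f ?ws" using lc[of "\<lambda>k. c $ k"] c by metis
  qed
  finally show ?thesis .
qed

text \<open>Write \<open>(A * b) *\<^sub>v c\<close> as \<open>A *\<^sub>v (b *\<^sub>v c)\<close>:
  a triangular \<open>b\<close> keeps the coordinates of \<open>c\<close> from \<open>i\<close> on
  equal to zero.\<close>

lemma vspan_take_cols_mult_triangular:
  assumes A: "A \<in> carrier_mat n n" and b: "b \<in> invertible_triangular n" and i: "i \<le> n"
  shows "vspan n (set (take i (cols (A * b)))) \<subseteq> vspan n (set (take i (cols A)))"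
proof
  have bc: "b \<in> carrier_mat n n" and u: "upper_triangular b"
    using b by (auto simp: invertible_triangular_def)
  fix v assume "v \<in> vspan n (set (take i (cols (A * b))))"
  then obtain c where c: "c \<in> carrier_vec n" "\<forall>k<n. i \<le> k \<longrightarrow> c $ k = 0" "v = (A * b) *\<^sub>v c"
    using in_vspan_take_cols_iff[of "A * b" n i v] A bc i by auto
  have "(b *\<^sub>v c) $ k = 0" if k: "k < n" "i \<le> k" for k
  proof -
    have "b $$ (k, l) * c $ l = 0" if "l < n" for l
      using upper_triangularD[OF u, of l k] c(2) that k bc by (cases "l < k") auto
    then show ?thesis using bc c k by (auto simp: scalar_prod_def intro!: sum.neutral)
  qed
  moreover have "v = A *\<^sub>v (b *\<^sub>v c)" using assoc_mult_mat_vec[OF A bc c(1)] c(3) by simp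
  moreover have "b *\<^sub>v c \<in> carrier_vec n" using bc c by simp
  ultimately show "v \<in> vspan n (set (take i (cols A)))"
    using in_vspan_take_cols_iff[OF A i] by blast
qed

text \<open>Triangular factors preserve every step of the flag: one inclusion comes from
  \<open>b\<close>, the other from its inverse. Conversely, the coordinates of the columns of
  \<open>g\<close> with respect to those of \<open>A\<close> form the triangular factor, which also
  absorbs the determinant of \<open>A\<close>.\<close>

lemma flag_cols:
  assumes A: "A \<in> carrier_mat n n" and d: "det A \<noteq> 0"
  shows "flag n (cols A) = {g \<in> carrier (SL n). \<exists>b\<in>invertible_triangular n. g = A * b}"
proof (intro equalityI subsetI)
  fix g assume "g \<in> {g \<in> carrier (SL n). \<exists>b\<in>invertible_triangular n. g = A * b}"
  then obtain b where g: "g \<in> carrier (SL n)" "b \<in> invertible_triangular n" "g = A * b" by auto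
  have bc: "b \<in> carrier_mat n n" using g by (auto simp: invertible_triangular_def)
  obtain c where c: "c \<in> invertible_triangular n" "b * c = 1\<^sub>m n"
    using invertible_triangular_inverse[OF g(2)] by metis
  have "c \<in> carrier_mat n n" using c by (auto simp: invertible_triangular_def)
  then have "A = g * c" using g(3) A bc c(2) by (simp add: assoc_mult_mat[of _ n n _ n _ n])
  moreover have "g \<in> carrier_mat n n" using A bc g by simp
  ultimately have "vspan n (set (take i (cols g))) = vspan n (set (take i (cols A)))" if "i \<le> n" for i
    using vspan_take_cols_mult_triangular[OF A g(2) that]
      vspan_take_cols_mult_triangular[OF _ c(1) that, of g] g(3) by (metis subset_antisym)
  then show "g \<in> flag n (cols A)" using g(1) unfolding flag_def by auto
next
  fix g assume "g \<in> flag n (cols A)"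
  then have g: "g \<in> carrier (SL n)" and
    sp: "\<And>i. i \<in> {1..n} \<Longrightarrow> vspan n (set (take i (cols g))) = vspan n (set (take i (cols A)))"
    by (auto simp: flag_def)
  have gc: "g \<in> carrier_mat n n" "det g = 1" using g by (auto simp: SL_def)
  \<comment> \<open>Columns are counted from 0, so column \<open>j\<close> first appears in step
    \<open>Suc j\<close>; its coordinates therefore vanish strictly beyond \<open>j\<close>, which
    leaves the diagonal free.\<close>
  have "\<exists>c\<in>carrier_vec n. (\<forall>k<n. j < k \<longrightarrow> c $ k = 0) \<and> col g j = A *\<^sub>v c" if j: "j < n" for j
  proof -
    have "col g j = g *\<^sub>v unit_vec n j" using gc j by (intro eq_vecI) auto
    then have "col g j \<in> vspan n (set (take (Suc j) (cols g)))"
      using in_vspan_take_cols_iff[OF gc(1), of "Suc j"] j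
      by (auto intro!: bexI[of _ "unit_vec n j"])
    then show ?thesis using sp[of "Suc j"] j in_vspan_take_cols_iff[OF A, of "Suc j"]
      by (auto simp: Suc_le_eq)
  qed
  then obtain c where c: "\<And>j. j < n \<Longrightarrow> c j \<in> carrier_vec n"
    "\<And>j k. j < n \<Longrightarrow> k < n \<Longrightarrow> j < k \<Longrightarrow> c j $ k = 0" "\<And>j. j < n \<Longrightarrow> col g j = A *\<^sub>v c j"
    by metis
  define b where "b = mat n n (\<lambda>(k, j). c j $ k)"
  have bc: "b \<in> carrier_mat n n" by (simp add: b_def)
  have "g = A * b"
  proof (rule mat_col_eqI)
    fix j assume "j < dim_col (A * b)"
    then have j: "j < n" using bc by simp
    have "col b j = c j" using j carrier_vecD[OF c(1)[OF j]] by (intro eq_vecI) (auto simp: b_def)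
    then show "col g j = col (A * b) j" using c(3)[OF j] col_mult2[OF A bc j] by simp
  qed (use gc A bc in auto)
  moreover have "det b \<noteq> 0" using det_mult[OF A bc] gc(2) \<open>g = A * b\<close> by auto
  moreover have "upper_triangular b" using c(2) by (auto simp: b_def)
  ultimately show "g \<in> {g \<in> carrier (SL n). \<exists>b\<in>invertible_triangular n. g = A * b}"
    using g bc by (auto simp: invertible_triangular_def)
qed


subsection \<open>Double cosets of the parabolic and the triangular matrices\<close>

definition double_coset_equiv :: "nat \<Rightarrow> nat \<Rightarrow> 'a :: field mat \<Rightarrow> 'a mat \<Rightarrow> bool" where
  "double_coset_equiv p q A C \<longleftrightarrow>
     (\<exists>x\<in>parabolic p q. \<exists>b\<in>invertible_triangular (p + q). A = x * C * b)"

lemma parabolicD: "x \<in> parabolic p q \<Longrightarrow> x \<in> carrier_mat (p + q) (p + q)"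
  by (simp add: parabolic_def)

lemma invertible_triangularD: "b \<in> invertible_triangular n \<Longrightarrow> b \<in> carrier_mat n n"
  by (simp add: invertible_triangular_def)

lemma one_invertible_triangular: "1\<^sub>m n \<in> invertible_triangular n"
  by (auto simp: invertible_triangular_def)

lemma double_coset_equiv_sym:
  assumes e: "double_coset_equiv p q A C" and C: "C \<in> carrier_mat (p + q) (p + q)"
  shows "double_coset_equiv p q C A"
proof -
  let ?n = "p + q"
  obtain x b where xb: "x \<in> parabolic p q" "b \<in> invertible_triangular ?n" "A = x * C * b"
    using e by (auto simp: double_coset_equiv_def)
  obtain y where y: "y \<in> parabolic p q" "y * x = 1\<^sub>m ?n" using parabolic_inverse[OF xb(1)] by metis
  obtain d where d: "d \<in> invertible_triangular ?n" "b * d = 1\<^sub>m ?n"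
    using invertible_triangular_inverse[OF xb(2)] by metis
  note c = parabolicD[OF xb(1)] parabolicD[OF y(1)] invertible_triangularD[OF xb(2)]
    invertible_triangularD[OF d(1)]
  have "y * A * d = (y * x) * C * (b * d)"
    unfolding xb(3) using c C by (simp add: assoc_mult_mat[of _ ?n ?n _ ?n _ ?n])
  also have "\<dots> = C" using y d C by simp
  finally show ?thesis using y(1) d(1) unfolding double_coset_equiv_def by metis
qed

lemma double_coset_equiv_trans:
  assumes e: "double_coset_equiv p q A C" "double_coset_equiv p q C D"
    and D: "D \<in> carrier_mat (p + q) (p + q)"
  shows "double_coset_equiv p q A D"
proof -
  let ?n = "p + q"
  obtain x b where xb: "x \<in> parabolic p q" "b \<in> invertible_triangular ?n" "A = x * C * b"
    using e by (auto simp: double_coset_equiv_def)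
  obtain y d where yd: "y \<in> parabolic p q" "d \<in> invertible_triangular ?n" "C = y * D * d"
    using e by (auto simp: double_coset_equiv_def)
  note c = parabolicD[OF xb(1)] parabolicD[OF yd(1)] invertible_triangularD[OF xb(2)]
    invertible_triangularD[OF yd(2)]
  have "A = (x * y) * D * (d * b)"
    unfolding xb(3) yd(3) using c D by (simp add: assoc_mult_mat[of _ ?n ?n _ ?n _ ?n])
  then show ?thesis
    using parabolic_mult[OF xb(1) yd(1)] invertible_triangular_mult[OF yd(2) xb(2)]
    unfolding double_coset_equiv_def by blast
qed

text \<open>In terms of the flag of the columns of \<open>A\<close>: the intersection of the step \<open>i + 1\<close> with the span of
  the first \<open>p\<close> unit vectors is larger than that of the step \<open>i\<close>.\<close>

definition column_into_block :: "nat \<Rightarrow> nat \<Rightarrow> 'a :: field mat \<Rightarrow> nat \<Rightarrow> bool" where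
  "column_into_block p q A i \<longleftrightarrow> (\<exists>c\<in>carrier_vec (p + q). c $ i \<noteq> 0 \<and>
     (\<forall>k<p + q. i < k \<longrightarrow> c $ k = 0) \<and> (\<forall>r<p + q. p \<le> r \<longrightarrow> (A *\<^sub>v c) $ r = 0))"

text \<open>From \<open>A = x * C * b\<close> a witness \<open>c\<close> for \<open>A\<close> yields
  the witness \<open>b *\<^sub>v c\<close> for \<open>C\<close>. Its last non-zero position is again
  \<open>i\<close>, because \<open>b\<close> is triangular with non-zero diagonal. Its image under
  \<open>C\<close> is the inverse of \<open>x\<close> applied to \<open>A *\<^sub>v c\<close>, and a
  parabolic matrix preserves the span of the first \<open>p\<close> unit vectors.\<close>

lemma column_into_block_cong:
  assumes e: "double_coset_equiv p q A C" and C: "C \<in> carrier_mat (p + q) (p + q)"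
    and i: "i < p + q" and A: "column_into_block p q A i"
  shows "column_into_block p q C i"
proof -
  let ?n = "p + q"
  obtain x b where xb: "x \<in> parabolic p q" "b \<in> invertible_triangular ?n" "A = x * C * b"
    using e by (auto simp: double_coset_equiv_def)
  obtain y where y: "y \<in> parabolic p q" "y * x = 1\<^sub>m ?n" using parabolic_inverse[OF xb(1)] by metis
  note m = parabolicD[OF xb(1)] parabolicD[OF y(1)] invertible_triangularD[OF xb(2)]
  obtain c where c: "c \<in> carrier_vec ?n" "c $ i \<noteq> 0" "\<And>k. k < ?n \<Longrightarrow> i < k \<Longrightarrow> c $ k = 0"
    "\<And>r. r < ?n \<Longrightarrow> p \<le> r \<Longrightarrow> (A *\<^sub>v c) $ r = 0"
    using A by (auto simp: column_into_block_def)
  have u: "upper_triangular b" and d: "det b \<noteq> 0"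
    using xb by (auto simp: invertible_triangular_def)
  have bii: "b $$ (i, i) \<noteq> 0"
    using upper_triangular_imp_det_eq_0_iff[OF m(3) u] d m i by (auto simp: diag_mat_def)
  \<comment> \<open>A surviving term needs \<open>k \<le> l\<close> because of \<open>b\<close> and
    \<open>l \<le> i\<close> because of \<open>c\<close>; with \<open>i \<le> k\<close> this forces
    \<open>k = l = i\<close>.\<close>
  have bc: "(b *\<^sub>v c) $ k = (if k = i then b $$ (i, i) * c $ i else 0)" if k: "k < ?n" "i \<le> k" for k
  proof -
    have "(b *\<^sub>v c) $ k = (\<Sum>l<?n. b $$ (k, l) * c $ l)"
      using m c k by (auto simp: scalar_prod_def atLeast0LessThan)
    also have "\<dots> = (\<Sum>l<?n. if l = i then (if k = i then b $$ (i, i) * c $ i else 0) else 0)"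
    proof (rule sum.cong[OF refl])
      fix l assume "l \<in> {..<?n}"
      then show "b $$ (k, l) * c $ l = (if l = i then (if k = i then b $$ (i, i) * c $ i else 0) else 0)"
        using c(3)[of l] upper_triangularD[OF u, of l k] k m
        by (cases "l < k"; cases "l = i"; cases "k = i") auto
    qed
    also have "\<dots> = (if k = i then b $$ (i, i) * c $ i else 0)" using i by simp
    finally show ?thesis .
  qed
  have "y * A = (y * x) * (C * b)"
    unfolding xb(3) using m C by (simp add: assoc_mult_mat[of _ ?n ?n _ ?n _ ?n])
  then have "C * b = y * A" using m C y(2) by simp
  moreover have Ac: "A \<in> carrier_mat ?n ?n" using xb m C by simp
  ultimately have Cb: "C *\<^sub>v (b *\<^sub>v c) = y *\<^sub>v (A *\<^sub>v c)"
    using assoc_mult_mat_vec[OF C m(3) c(1)] assoc_mult_mat_vec[OF m(2) Ac c(1)] by simp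
  have "(C *\<^sub>v (b *\<^sub>v c)) $ r = 0" if r: "r < ?n" "p \<le> r" for r
  proof -
    have "y $$ (r, l) * (A *\<^sub>v c) $ l = 0" if "l < ?n" for l
      using c(4)[of l] that y(1) r by (cases "l < p") (auto simp: parabolic_def)
    then show ?thesis unfolding Cb
      using m Ac c r by (auto simp: scalar_prod_def intro!: sum.neutral)
  qed
  moreover have "b *\<^sub>v c \<in> carrier_vec ?n" using m c(1) by simp
  moreover have "(b *\<^sub>v c) $ i \<noteq> 0" using bc[OF i order_refl] bii c(2) by simp
  moreover have "\<forall>k<?n. i < k \<longrightarrow> (b *\<^sub>v c) $ k = 0" using bc by simp
  ultimately show ?thesis unfolding column_into_block_def by blast
qed

section \<open>Permutation matrices as representatives of double cosets\<close>

text \<open>The convention is that column \<open>j\<close> is the unit vector with index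
  \<open>\<sigma> j\<close>: products then follow composition in the same order, and the columns
  match the vectors of the unmatched signs of a clan.\<close>

definition permutation_mat :: "nat \<Rightarrow> (nat \<Rightarrow> nat) \<Rightarrow> 'a :: field mat" where
  "permutation_mat n \<sigma> = mat n n (\<lambda>(i, j). if i = \<sigma> j then 1 else 0)"

lemma permutation_mat_carrier [simp]: "permutation_mat n \<sigma> \<in> carrier_mat n n"
  by (simp add: permutation_mat_def)

lemma mult_permutation_mat_index:
  assumes "A \<in> carrier_mat n n" "i < n" "j < n" "\<sigma> j < n"
  shows "(A * permutation_mat n \<sigma>) $$ (i, j) = A $$ (i, \<sigma> j)"
  using assms by (auto simp: permutation_mat_def scalar_prod_def if_distrib cong: if_cong)

lemma permutes_less:
  fixes n j :: nat
  assumes "\<sigma> permutes {0..<n}" "j < n" shows "\<sigma> j < n"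
  using permutes_in_image[OF assms(1), of j] assms(2) by simp

lemma permutation_mat_mult:
  assumes "\<rho> permutes {0..<n}"
  shows "permutation_mat n \<sigma> * permutation_mat n \<rho> = permutation_mat n (\<sigma> \<circ> \<rho>)"
proof (rule eq_matI)
  fix i j assume "i < dim_row (permutation_mat n (\<sigma> \<circ> \<rho>) :: 'a mat)"
    "j < dim_col (permutation_mat n (\<sigma> \<circ> \<rho>) :: 'a mat)"
  then have ij: "i < n" "j < n" by (auto simp: permutation_mat_def)
  show "(permutation_mat n \<sigma> * permutation_mat n \<rho>) $$ (i, j)
      = (permutation_mat n (\<sigma> \<circ> \<rho>) :: 'a mat) $$ (i, j)"
    unfolding mult_permutation_mat_index[where \<sigma> = \<rho>, OF permutation_mat_carrier ij permutes_less[OF assms ij(2)]]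
    using ij permutes_less[OF assms ij(2)] by (simp add: permutation_mat_def)
qed (auto simp: permutation_mat_def)

lemma det_permutation_mat_neq_0:
  assumes "\<sigma> permutes {0..<n}" shows "det (permutation_mat n \<sigma> :: 'a :: field mat) \<noteq> 0"
proof -
  have "permutation_mat n (inv_into UNIV \<sigma>) * permutation_mat n \<sigma> = (1\<^sub>m n :: 'a mat)"
    unfolding permutation_mat_mult[OF assms] permutes_inv_o(2)[OF assms]
    by (auto simp: permutation_mat_def)
  then have "det (permutation_mat n (inv_into UNIV \<sigma>)) * det (permutation_mat n \<sigma> :: 'a mat) = 1"
    using det_mult[of "permutation_mat n (inv_into UNIV \<sigma>) :: 'a mat" n "permutation_mat n \<sigma>"] by simp
  then show ?thesis by auto
qed

text \<open>The permutation matrix carries coordinate \<open>i\<close> to position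
  \<open>\<sigma> i\<close>. A non-zero coordinate there is allowed only if this position lies in
  the first block, and in that case the unit vector with index \<open>i\<close> is a
  witness.\<close>

lemma column_into_block_permutation_mat:
  assumes s: "\<sigma> permutes {0..<p + q}" and i: "i < p + q"
  shows "column_into_block p q (permutation_mat (p + q) \<sigma>) i \<longleftrightarrow> \<sigma> i < p"
proof -
  let ?n = "p + q"
  have ent: "(permutation_mat ?n \<sigma> *\<^sub>v c) $ (\<sigma> j) = c $ j"
    if "c \<in> carrier_vec ?n" "j < ?n" for c :: "'a vec" and j
  proof -
    have "(permutation_mat ?n \<sigma> *\<^sub>v c) $ (\<sigma> j)
        = (\<Sum>k<?n. (if \<sigma> j = \<sigma> k then 1 else 0) * c $ k)"
      using that permutes_less[OF s that(2)]
      by (simp add: permutation_mat_def scalar_prod_def atLeast0LessThan)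
    also have "\<dots> = (\<Sum>k<?n. if k = j then c $ k else 0)"
      by (rule sum.cong[OF refl]) (use inj_eq[OF permutes_inj[OF s]] in auto)
    finally show ?thesis using that by simp
  qed
  show ?thesis
  proof
    assume "column_into_block p q (permutation_mat ?n \<sigma> :: 'a mat) i"
    then obtain c :: "'a vec" where c: "c \<in> carrier_vec ?n" "c $ i \<noteq> 0"
      "\<And>r. r < ?n \<Longrightarrow> p \<le> r \<Longrightarrow> (permutation_mat ?n \<sigma> *\<^sub>v c) $ r = 0"
      by (auto simp: column_into_block_def)
    then show "\<sigma> i < p" using ent[OF c(1) i] permutes_less[OF s i] by (metis not_le)
  next
    assume lt: "\<sigma> i < p"
    have "(permutation_mat ?n \<sigma> *\<^sub>v unit_vec ?n i) $ r = (0 :: 'a)" if r: "r < ?n" "p \<le> r" for r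
    proof -
      have j: "inv_into UNIV \<sigma> r < ?n" "\<sigma> (inv_into UNIV \<sigma> r) = r"
        using permutes_less[OF permutes_inv[OF s] r(1)] permutes_inverses(1)[OF s] by auto
      then have "inv_into UNIV \<sigma> r \<noteq> i" using lt r by auto
      with ent[of "unit_vec ?n i" "inv_into UNIV \<sigma> r"] j i show ?thesis by simp
    qed
    moreover have "unit_vec ?n i \<in> carrier_vec ?n" "unit_vec ?n i $ i \<noteq> (0 :: 'a)"
      "\<forall>k<?n. i < k \<longrightarrow> unit_vec ?n i $ k = (0 :: 'a)" using i by auto
    ultimately show "column_into_block p q (permutation_mat ?n \<sigma> :: 'a mat) i"
      unfolding column_into_block_def by blast
  qed
qed

text \<open>One direction is the invariance of \<open>column_into_block\<close> under both factors.
  For the other, the quotient of the two permutations preserves the first block, so its matrix is a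
  parabolic factor, and the triangular factor is the identity.\<close>

lemma double_coset_equiv_permutation_mat_iff:
  assumes s: "\<sigma> permutes {0..<p + q}" and r: "\<rho> permutes {0..<p + q}"
  shows "double_coset_equiv p q (permutation_mat (p + q) \<sigma> :: 'a :: field mat)
      (permutation_mat (p + q) \<rho>) \<longleftrightarrow> (\<forall>i<p + q. \<sigma> i < p \<longleftrightarrow> \<rho> i < p)"
proof
  let ?n = "p + q"
  assume e: "double_coset_equiv p q (permutation_mat ?n \<sigma> :: 'a mat) (permutation_mat ?n \<rho>)"
  note e' = double_coset_equiv_sym[OF e permutation_mat_carrier]
  show "\<forall>i<?n. \<sigma> i < p \<longleftrightarrow> \<rho> i < p"
    using column_into_block_cong[OF e permutation_mat_carrier]
      column_into_block_cong[OF e' permutation_mat_carrier]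
      column_into_block_permutation_mat[OF s, where 'a = 'a]
      column_into_block_permutation_mat[OF r, where 'a = 'a] by blast
next
  let ?n = "p + q"
  assume eq: "\<forall>i<?n. \<sigma> i < p \<longleftrightarrow> \<rho> i < p"
  \<comment> \<open>For \<open>j < p\<close> the position that \<open>\<rho>\<close> sends to
    \<open>j\<close> is also sent below \<open>p\<close> by \<open>\<sigma>\<close>; hence
    \<open>\<pi>\<close> maps the first \<open>p\<close> indices to themselves.\<close>
  define \<pi> where "\<pi> = \<sigma> \<circ> inv_into UNIV \<rho>"
  have pi: "\<pi> permutes {0..<?n}" unfolding \<pi>_def by (rule permutes_compose[OF permutes_inv[OF r] s])
  have "\<pi> j < p" if "j < p" for j
  proof -
    have "inv_into UNIV \<rho> j < ?n" using permutes_less[OF permutes_inv[OF r], of j] that by simp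
    then show ?thesis using eq permutes_inverses(1)[OF r, of j] that by (simp add: \<pi>_def)
  qed
  then have x: "(permutation_mat ?n \<pi> :: 'a mat) \<in> parabolic p q"
    using det_permutation_mat_neq_0[OF pi, where 'a = 'a]
    unfolding parabolic_def by (simp add: permutation_mat_def) fastforce
  have "\<pi> \<circ> \<rho> = \<sigma>" unfolding \<pi>_def using permutes_inv_o(2)[OF r] by (simp add: comp_assoc)
  then have "permutation_mat ?n \<sigma> = permutation_mat ?n \<pi> * permutation_mat ?n \<rho> * (1\<^sub>m ?n :: 'a mat)"
    using right_mult_one_mat[OF permutation_mat_carrier] permutation_mat_mult[OF r] by metis
  then show "double_coset_equiv p q (permutation_mat ?n \<sigma> :: 'a mat) (permutation_mat ?n \<rho>)"
    unfolding double_coset_equiv_def using x one_invertible_triangular by blast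
qed

subsection \<open>Matrices of clans\<close>

definition clan_mat :: "clan \<Rightarrow> (nat \<Rightarrow> nat) \<Rightarrow> complex mat" where
  "clan_mat \<gamma> \<sigma> = mat_of_cols (length \<gamma>) (map (clan_vec \<gamma> \<sigma>) [0..<length \<gamma>])"

lemma clan_vec_carrier: "clan_vec \<gamma> \<sigma> i \<in> carrier_vec (length \<gamma>)"
  by (auto simp: clan_vec_def Let_def split: entry.split)

lemma cols_clan_mat: "cols (clan_mat \<gamma> \<sigma>) = map (clan_vec \<gamma> \<sigma>) [0..<length \<gamma>]"
  unfolding clan_mat_def using clan_vec_carrier by (intro cols_mat_of_cols) auto

lemma clan_mat_carrier: "clan_mat \<gamma> \<sigma> \<in> carrier_mat (length \<gamma>) (length \<gamma>)"
  by (rule carrier_matI) (simp_all add: clan_mat_def)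

lemma signature_not_Num: "signature \<gamma> i = Plus \<or> signature \<gamma> i = Minus"
  by (auto simp: signature_def split: entry.split)

lemma admissible_less_iff:
  assumes "admissible p q \<gamma> \<sigma>" "i < p + q" shows "\<sigma> i < p \<longleftrightarrow> signature \<gamma> i = Plus"
  using assms by (fastforce simp: admissible_def split: if_splits)

text \<open>Adding the vector of the first mate to that of the second mate gives twice the unit vector of
  the second; the vectors of the first mates differ from negative unit vectors by unit vectors with index less than
  \<open>p\<close>, a difference that a parabolic matrix removes.\<close>

lemma clan_mat_equiv_permutation_mat:
  assumes c: "is_clan p q \<gamma>" and a: "admissible p q \<gamma> \<sigma>"
  shows "double_coset_equiv p q (clan_mat \<gamma> \<sigma>) (permutation_mat (p + q) \<sigma>)"
proof -
  let ?n = "p + q"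
  have len: "length \<gamma> = ?n" using c by (simp add: is_clan_def)
  have s: "\<sigma> permutes {0..<?n}" using a by (simp add: admissible_def)
  note less = permutes_less[OF s] and sig = admissible_less_iff[OF a]
  define N where "N i \<longleftrightarrow> (\<exists>k. \<gamma> ! i = Num k)" for i
  have mt: "mate \<gamma> i < ?n" "mate \<gamma> i \<noteq> i" "signature \<gamma> i = Plus \<longleftrightarrow> mate \<gamma> i < i"
    "N (mate \<gamma> i)" "mate \<gamma> (mate \<gamma> i) = i" if "i < ?n" "N i" for i
  proof -
    obtain k where k: "\<gamma> ! i = Num k" using \<open>N i\<close> by (auto simp: N_def)
    note m = mate[OF c \<open>i < ?n\<close> k]
    show "mate \<gamma> i < ?n" "mate \<gamma> i \<noteq> i" "mate \<gamma> (mate \<gamma> i) = i" "N (mate \<gamma> i)"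
      using m by (auto simp: N_def)
    show "signature \<gamma> i = Plus \<longleftrightarrow> mate \<gamma> i < i" using m(2) k by (auto simp: signature_def)
  qed
  \<comment> \<open>Mates have opposite signatures, so exactly one of the two has its image under
    \<open>\<sigma>\<close> below \<open>p\<close>.\<close>
  have sm: "signature \<gamma> (mate \<gamma> i) = Plus \<longleftrightarrow> signature \<gamma> i \<noteq> Plus" if "i < ?n" "N i" for i
    using mt[OF that] mt(3)[of "mate \<gamma> i"] by auto
  have V: "clan_vec \<gamma> \<sigma> i $ r = (if N i then
      (if signature \<gamma> i = Plus then 1 else - 1) * (if r = \<sigma> i then 1 else 0) + (if r = \<sigma> (mate \<gamma> i) then 1 else 0)
      else if r = \<sigma> i then 1 else 0)" if "i < ?n" "r < ?n" for i r
  proof (cases "\<gamma> ! i")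
    case (Num k)
    then have Ni: "N i" by (simp add: N_def)
    have "\<sigma> i < ?n" "\<sigma> (mate \<gamma> i) < ?n"
      using less[OF that(1)] less[OF mt(1)[OF that(1) Ni]] .
    then show ?thesis using Ni Num that by (simp add: clan_vec_def len Let_def)
  next
    case Plus
    then have "\<not> N i" by (simp add: N_def)
    then show ?thesis using Plus that less[OF that(1)] by (simp add: clan_vec_def len Let_def)
  next
    case Minus
    then have "\<not> N i" by (simp add: N_def)
    then show ?thesis using Minus that less[OF that(1)] by (simp add: clan_vec_def len Let_def)
  qed
  \<comment> \<open>\<open>X\<close> sends the unit vector with index \<open>\<sigma> k\<close> to
    itself if position \<open>k\<close> has signature \<open>Plus\<close>, and to the clan vector of
    \<open>k\<close> otherwise.\<close>
  define X :: "complex mat" where "X = mat ?n ?n (\<lambda>(r, s).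
    if s < p then (if r = s then 1 else 0) else clan_vec \<gamma> \<sigma> (inv_into UNIV \<sigma> s) $ r)"
  \<comment> \<open>For a second mate \<open>j\<close> the clan vector is twice the unit vector with
    index \<open>\<sigma> j\<close> minus the clan vector of the first mate: this gives the entries
    2 and -1. All other columns stay fixed. The mate precedes \<open>j\<close>, so \<open>B\<close>
    is upper triangular.\<close>
  define B :: "complex mat" where "B = mat ?n ?n (\<lambda>(k, j).
    if N j \<and> signature \<gamma> j = Plus then (if k = j then 2 else if k = mate \<gamma> j then - 1 else 0)
    else if k = j then 1 else 0)"
  have XB: "X \<in> carrier_mat ?n ?n" "B \<in> carrier_mat ?n ?n" by (auto simp: X_def B_def)
  \<comment> \<open>An index \<open>s \<ge> p\<close> comes from a position of signature
    \<open>Minus\<close>. The second entry of its clan vector, if there is one, sits at the image of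
    the mate, which is below \<open>p\<close> and hence above the diagonal.\<close>
  have Xv: "clan_vec \<gamma> \<sigma> (inv_into UNIV \<sigma> s) $ r = (if r = s then (if N (inv_into UNIV \<sigma> s) then - 1 else 1) else 0)"
    if rs: "r < ?n" "s < ?n" "p \<le> s" "s \<le> r" for r s
  proof -
    let ?k = "inv_into UNIV \<sigma> s"
    have k: "?k < ?n" "\<sigma> ?k = s"
      using permutes_less[OF permutes_inv[OF s] rs(2)] permutes_inverses(1)[OF s] by auto
    have "signature \<gamma> ?k \<noteq> Plus" using sig[OF k(1)] k(2) rs by simp
    moreover have "\<sigma> (mate \<gamma> ?k) < p" if "N ?k"
      using sm[OF k(1) that] sig[OF mt(1)[OF k(1) that]] calculation by simp
    ultimately show ?thesis using V[OF k(1) rs(1)] k(2) rs by auto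
  qed
  have uX: "upper_triangular X" using Xv by (auto simp: X_def)
  have "X $$ (i, i) \<noteq> 0" if "i < ?n" for i using Xv[of i i] that by (auto simp: X_def)
  then have dX: "det X \<noteq> 0"
    using upper_triangular_imp_det_eq_0_iff[OF XB(1) uX] XB by (auto simp: diag_mat_def)
  then have X: "X \<in> parabolic p q" by (auto simp: parabolic_def X_def)
  have uB: "upper_triangular B"
    using mt(3) by (auto simp: B_def)
  have "B $$ (i, i) \<noteq> 0" if "i < ?n" for i using that by (auto simp: B_def)
  then have "det B \<noteq> 0"
    using upper_triangular_imp_det_eq_0_iff[OF XB(2) uB] XB by (auto simp: diag_mat_def)
  then have B: "B \<in> invertible_triangular ?n" using uB XB by (simp add: invertible_triangular_def)
  let ?Y = "X * permutation_mat ?n \<sigma>"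
  have Yc: "?Y \<in> carrier_mat ?n ?n" using XB by simp
  \<comment> \<open>Column \<open>\<sigma> k\<close> of \<open>X\<close> has moved to position
    \<open>k\<close>: at signature \<open>Minus\<close> it is already the clan vector, at
    \<open>Plus\<close> still a unit vector to be corrected by \<open>B\<close> for second
    mates.\<close>
  have Y: "?Y $$ (r, k) = (if signature \<gamma> k = Plus then (if r = \<sigma> k then 1 else 0) else clan_vec \<gamma> \<sigma> k $ r)"
    if "r < ?n" "k < ?n" for r k
    using mult_permutation_mat_index[where \<sigma> = \<sigma>, OF XB(1) that less[OF that(2)]] sig[OF that(2)]
      less[OF that(2)] permutes_inverses(2)[OF s] that by (simp add: X_def)
  have "clan_mat \<gamma> \<sigma> = ?Y * B"
  proof (rule eq_matI)
    fix r j assume "r < dim_row (?Y * B)" "j < dim_col (?Y * B)"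
    then have rj: "r < ?n" "j < ?n" using XB by auto
    have "(M * B) $$ (r, j) = (\<Sum>k<?n. M $$ (r, k) * B $$ (k, j))"
      if "M \<in> carrier_mat ?n ?n" for M
      using rj that XB by (simp add: scalar_prod_def atLeast0LessThan)
    then have "(?Y * B) $$ (r, j) = (\<Sum>k<?n. ?Y $$ (r, k) * B $$ (k, j))" using Yc .
    also have "\<dots> = clan_vec \<gamma> \<sigma> j $ r"
    proof (cases "N j \<and> signature \<gamma> j = Plus")
      case True
      note m = mt[OF rj(2) conjunct1[OF True]]
      have "(\<Sum>k<?n. ?Y $$ (r, k) * B $$ (k, j)) = (\<Sum>k\<in>{j, mate \<gamma> j}. ?Y $$ (r, k) * B $$ (k, j))"
        using m(1) rj True by (intro sum.mono_neutral_right) (auto simp: B_def)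
      also have "\<dots> = 2 * ?Y $$ (r, j) - ?Y $$ (r, mate \<gamma> j)"
        using m(1,2) rj True by (simp add: B_def)
      also have "\<dots> = clan_vec \<gamma> \<sigma> j $ r"
        using Y[OF rj] Y[OF rj(1) m(1)] V[OF rj(2,1)] V[OF m(1) rj(1)] True m sm[OF rj(2)]
        by auto
      finally show ?thesis .
    next
      case False
      have "(\<Sum>k<?n. ?Y $$ (r, k) * B $$ (k, j)) = (\<Sum>k\<in>{j}. ?Y $$ (r, k) * B $$ (k, j))"
        using rj False by (intro sum.mono_neutral_right) (auto simp: B_def)
      also have "\<dots> = ?Y $$ (r, j)" using rj False by (auto simp: B_def)
      also have "\<dots> = clan_vec \<gamma> \<sigma> j $ r" using Y[OF rj] V[OF rj(2,1)] False by auto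
      finally show ?thesis .
    qed
    finally show "clan_mat \<gamma> \<sigma> $$ (r, j) = (?Y * B) $$ (r, j)"
      using rj by (simp add: clan_mat_def len mat_of_cols_index)
  qed (use XB in \<open>auto simp: clan_mat_def len\<close>)
  then show ?thesis using X B unfolding double_coset_equiv_def by blast
qed

text \<open>All three factors of the decomposition through the permutation matrix are invertible. So
  the clan vectors form a basis and \<open>flag_cols\<close> applies to them.\<close>

lemma det_clan_mat_neq_0:
  assumes c: "is_clan p q \<gamma>" and a: "admissible p q \<gamma> \<sigma>"
  shows "det (clan_mat \<gamma> \<sigma>) \<noteq> 0"
proof -
  let ?n = "p + q"
  obtain x b where xb: "x \<in> parabolic p q" "b \<in> invertible_triangular ?n"
    "clan_mat \<gamma> \<sigma> = x * permutation_mat ?n \<sigma> * b"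
    using clan_mat_equiv_permutation_mat[OF c a] by (auto simp: double_coset_equiv_def)
  have "\<sigma> permutes {0..<?n}" using a by (simp add: admissible_def)
  with xb show ?thesis
    using det_mult[of "x * permutation_mat ?n \<sigma>" ?n b] det_mult[of x ?n "permutation_mat ?n \<sigma>"]
      det_permutation_mat_neq_0[of \<sigma> ?n, where 'a = complex]
    by (auto simp: parabolic_def invertible_triangular_def)
qed

subsection \<open>Images of orbits\<close>

lemma SL_simps:
  "x \<otimes>\<^bsub>SL n\<^esub> y = x * y" "\<one>\<^bsub>SL n\<^esub> = 1\<^sub>m n"
  "x \<in> carrier (SL n) \<longleftrightarrow> x \<in> carrier_mat n n \<and> det x = 1"
  by (auto simp: SL_def)

lemma subgroup_Pgrp: "subgroup (Pgrp p q) (SL (p + q))"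
proof -
  interpret group "SL (p + q)" by (rule group_SL)
  show ?thesis
  proof
    fix a assume a: "a \<in> Pgrp p q"
    then have par: "a \<in> parabolic p q" "det a = 1" by (auto simp: Pgrp_iff_parabolic)
    obtain b where b: "b \<in> parabolic p q" "b * a = 1\<^sub>m (p + q)"
      using parabolic_inverse[OF par(1)] by metis
    have "det b = 1" using det_mult[OF parabolicD[OF b(1)] parabolicD[OF par(1)]] par b by simp
    then have "b \<in> Pgrp p q" using b by (simp add: Pgrp_iff_parabolic)
    moreover have "inv\<^bsub>SL (p + q)\<^esub> a = b"
      using Pgrp_subset a \<open>b \<in> Pgrp p q\<close> b(2) by (intro inv_equality) (auto simp: SL_simps(1,2))
    ultimately show "inv\<^bsub>SL (p + q)\<^esub> a \<in> Pgrp p q" by simp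
  qed (use Pgrp_subset Pgrp_mult one_in_Lgrp Lgrp_subset_Pgrp in \<open>force simp: SL_simps(1,2)\<close>)+
qed

lemma l_coset_mem_iff:
  assumes "F \<subseteq> carrier_mat n n"
  shows "x \<in> l <#\<^bsub>SL n\<^esub> F \<longleftrightarrow> (\<exists>f\<in>F. x = l * f)"
  by (auto simp: l_coset_def SL_simps)

lemma Bgrp_iff: "b \<in> Bgrp n \<longleftrightarrow> b \<in> invertible_triangular n \<and> det b = 1"
  by (auto simp: Bgrp_def invertible_triangular_def SL_simps)

text \<open>The flag consists of the matrices \<open>V * b\<close> of determinant 1, so a translate
  of it is a single coset of \<open>Bgrp\<close>, which is determined by any one of its elements.
  The triangular factor carries no determinant condition of its own: it is fixed by those of
  \<open>g\<close>, \<open>l\<close> and \<open>V\<close>.\<close>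

lemma mem_Q_orbit_iff:
  assumes c: "is_clan p q \<gamma>" and a: "admissible p q \<gamma> \<sigma>" and g: "g \<in> carrier (SL (p + q))"
  shows "g <#\<^bsub>SL (p + q)\<^esub> Bgrp (p + q) \<in> Q_orbit p q \<gamma> \<sigma> \<longleftrightarrow>
    (\<exists>l\<in>Lgrp p q. \<exists>b\<in>invertible_triangular (p + q). g = l * clan_mat \<gamma> \<sigma> * b)"
proof -
  let ?n = "p + q" and ?V = "clan_mat \<gamma> \<sigma>"
  let ?F = "clan_flag \<gamma> \<sigma>"
  have len: "length \<gamma> = ?n" using c by (simp add: is_clan_def)
  have V: "?V \<in> carrier_mat ?n ?n" "det ?V \<noteq> 0"
    using clan_mat_carrier[of \<gamma> \<sigma>] det_clan_mat_neq_0[OF c a] by (auto simp: len)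
  have F: "?F = {h \<in> carrier (SL ?n). \<exists>b\<in>invertible_triangular ?n. h = ?V * b}"
    unfolding clan_flag_def cols_clan_mat[symmetric] using flag_cols[OF V] len by simp
  have Fc: "?F \<subseteq> carrier_mat ?n ?n" and Bc: "Bgrp ?n \<subseteq> carrier_mat ?n ?n"
    by (auto simp: F SL_simps Bgrp_def)
  have gm: "g \<in> carrier_mat ?n ?n" "det g = 1" using g by (auto simp: SL_simps)
  have Lc: "l \<in> carrier_mat ?n ?n" "det l = 1" if "l \<in> Lgrp p q" for l
  proof -
    have "l \<in> carrier (SL ?n)" using that Lgrp_subset_Pgrp Pgrp_subset by blast
    then show "l \<in> carrier_mat ?n ?n" "det l = 1" by (simp_all add: SL_simps)
  qed
  have as: "A * B * C = A * (B * C)"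
    if "A \<in> carrier_mat ?n ?n" "B \<in> carrier_mat ?n ?n" "C \<in> carrier_mat ?n ?n" for A B C :: "complex mat"
    using that by (rule assoc_mult_mat)
  show ?thesis
  proof
    assume "g <#\<^bsub>SL ?n\<^esub> Bgrp ?n \<in> Q_orbit p q \<gamma> \<sigma>"
    then obtain l where l: "l \<in> Lgrp p q" "g <#\<^bsub>SL ?n\<^esub> Bgrp ?n = l <#\<^bsub>SL ?n\<^esub> ?F"
      by (auto simp: Q_orbit_def)
    \<comment> \<open>Equality of the two cosets is evaluated at the element \<open>g\<close>
      itself.\<close>
    have "1\<^sub>m ?n \<in> Bgrp ?n" using one_invertible_triangular by (simp add: Bgrp_iff)
    then have "g \<in> g <#\<^bsub>SL ?n\<^esub> Bgrp ?n"
      unfolding l_coset_mem_iff[OF Bc] using gm by (intro bexI[of _ "1\<^sub>m ?n"]) simp_all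
    then obtain f where f: "f \<in> ?F" "g = l * f" unfolding l l_coset_mem_iff[OF Fc] by auto
    then obtain b where b: "b \<in> invertible_triangular ?n" "f = ?V * b" using F by auto
    have "g = l * ?V * b"
      using as[OF Lc(1)[OF l(1)] V(1) invertible_triangularD[OF b(1)]] f(2) b(2) by simp
    then show "\<exists>l\<in>Lgrp p q. \<exists>b\<in>invertible_triangular ?n. g = l * ?V * b" using l(1) b(1) by blast
  next
    assume "\<exists>l\<in>Lgrp p q. \<exists>b\<in>invertible_triangular ?n. g = l * ?V * b"
    then obtain l b where lb: "l \<in> Lgrp p q" "b \<in> invertible_triangular ?n" "g = l * ?V * b" by auto
    note bc = invertible_triangularD[OF lb(2)] and lc = Lc[OF lb(1)]
    \<comment> \<open>The inverse of \<open>b\<close> rewrites \<open>l * V * b'\<close> as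
      \<open>g * (d * b')\<close>; the factor \<open>d * b'\<close> has determinant 1 since the
      product and \<open>g\<close> do.\<close>
    obtain d where d: "d \<in> invertible_triangular ?n" "b * d = 1\<^sub>m ?n"
      using invertible_triangular_inverse[OF lb(2)] by metis
    note dc = invertible_triangularD[OF d(1)]
    have "g <#\<^bsub>SL ?n\<^esub> Bgrp ?n = l <#\<^bsub>SL ?n\<^esub> ?F"
    proof (intro equalityI subsetI)
      fix x assume "x \<in> g <#\<^bsub>SL ?n\<^esub> Bgrp ?n"
      then obtain b' where b': "b' \<in> Bgrp ?n" "x = g * b'" unfolding l_coset_mem_iff[OF Bc] by auto
      then have b't: "b' \<in> invertible_triangular ?n" "det b' = 1" by (auto simp: Bgrp_iff)
      note b'c = invertible_triangularD[OF b't(1)]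
      have bb: "b * b' \<in> invertible_triangular ?n" by (rule invertible_triangular_mult[OF lb(2) b't(1)])
      have x: "x = l * (?V * (b * b'))"
        unfolding b'(2) lb(3) using lc V bc b'c by (simp add: as)
      have Vbb: "?V * (b * b') \<in> carrier_mat ?n ?n" using V bc b'c by simp
      have "det x = 1" unfolding b'(2) using det_mult[OF gm(1) b'c] gm b't by simp
      then have "det (?V * (b * b')) = 1" unfolding x using det_mult[OF lc(1) Vbb] lc by simp
      then have "?V * (b * b') \<in> ?F" using F Vbb bb by (auto simp: SL_simps)
      then show "x \<in> l <#\<^bsub>SL ?n\<^esub> ?F" using x unfolding l_coset_mem_iff[OF Fc] by blast
    next
      fix x assume "x \<in> l <#\<^bsub>SL ?n\<^esub> ?F"
      then obtain f where f: "f \<in> ?F" "x = l * f" unfolding l_coset_mem_iff[OF Fc] by auto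
      then obtain b' where b': "b' \<in> invertible_triangular ?n" "f = ?V * b'"
        and fc: "f \<in> carrier_mat ?n ?n" "det f = 1" unfolding F by (auto simp: SL_simps)
      note b'c = invertible_triangularD[OF b'(1)]
      have db: "d * b' \<in> invertible_triangular ?n" by (rule invertible_triangular_mult[OF d(1) b'(1)])
      have "g * (d * b') = l * ?V * ((b * d) * b')"
        unfolding lb(3) using lc V bc b'c dc by (simp add: as)
      also have "\<dots> = x" unfolding f(2) b'(2) d(2) using lc V b'c by (simp add: as)
      finally have x: "x = g * (d * b')" ..
      have dbc: "d * b' \<in> carrier_mat ?n ?n" using dc b'c by simp
      have "det x = 1" unfolding f(2) using det_mult[OF lc(1) fc(1)] lc fc by simp
      then have "det (d * b') = 1" unfolding x using det_mult[OF gm(1) dbc] gm by simp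
      then have "d * b' \<in> Bgrp ?n" using db by (simp add: Bgrp_iff)
      then show "x \<in> g <#\<^bsub>SL ?n\<^esub> Bgrp ?n" using x unfolding l_coset_mem_iff[OF Bc] by blast
    qed
    then show "g <#\<^bsub>SL ?n\<^esub> Bgrp ?n \<in> Q_orbit p q \<gamma> \<sigma>" using lb(1) unfolding Q_orbit_def by blast
  qed
qed

section \<open>Images of orbits as sets of cosets of the parabolic subgroup\<close>

text \<open>After inversion the factor \<open>l\<close> stands next to \<open>Pgrp\<close> and is
  absorbed by it. The set therefore depends only on the double coset of \<open>V\<close>, as the
  next lemmas make precise.\<close>

definition image_cosets :: "nat \<Rightarrow> nat \<Rightarrow> complex mat \<Rightarrow> complex mat set set" where
  "image_cosets p q V = {inv\<^bsub>SL (p + q)\<^esub> g <#\<^bsub>SL (p + q)\<^esub> Pgrp p q | g. g \<in> carrier (SL (p + q)) \<and>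
     (\<exists>l\<in>Lgrp p q. \<exists>b\<in>invertible_triangular (p + q). g = l * V * b)}"

text \<open>Both sides are images of the same set of matrices \<open>g\<close>; on each coset the
  projection enlarges \<open>Lgrp\<close> to \<open>Pgrp\<close> by
  \<open>proj_coset\<close>.\<close>

lemma proj_R_orbit:
  assumes c: "is_clan p q \<gamma>" and a: "admissible p q \<gamma> \<sigma>"
  shows "proj p q ` R_orbit p q \<gamma> \<sigma> = image_cosets p q (clan_mat \<gamma> \<sigma>)"
proof -
  interpret group "SL (p + q)" by (rule group_SL)
  define S where "S = {g \<in> carrier (SL (p + q)).
    \<exists>l\<in>Lgrp p q. \<exists>b\<in>invertible_triangular (p + q). g = l * clan_mat \<gamma> \<sigma> * b}"
  have "R_orbit p q \<gamma> \<sigma> = (\<lambda>g. inv\<^bsub>SL (p + q)\<^esub> g <#\<^bsub>SL (p + q)\<^esub> Lgrp p q) ` S"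
    unfolding R_orbit_def S_def using mem_Q_orbit_iff[OF c a] by blast
  then have "proj p q ` R_orbit p q \<gamma> \<sigma> = (\<lambda>g. proj p q (inv\<^bsub>SL (p + q)\<^esub> g <#\<^bsub>SL (p + q)\<^esub> Lgrp p q)) ` S"
    by (simp only: image_image)
  also have "\<dots> = (\<lambda>g. inv\<^bsub>SL (p + q)\<^esub> g <#\<^bsub>SL (p + q)\<^esub> Pgrp p q) ` S"
    by (rule image_cong[OF refl]) (rule proj_coset, simp add: S_def)
  also have "\<dots> = image_cosets p q (clan_mat \<gamma> \<sigma>)"
    unfolding image_cosets_def S_def by blast
  finally show ?thesis .
qed

text \<open>The determinant of the parabolic factor can be moved into the triangular one by a scalar,
  because the complex numbers contain roots.\<close>

lemma image_cosets_mono: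
  assumes n: "p + q > 0" and W: "W \<in> carrier_mat (p + q) (p + q)"
    and e: "double_coset_equiv p q V W"
  shows "image_cosets p q V \<subseteq> image_cosets p q W"
proof
  let ?n = "p + q"
  interpret group "SL ?n" by (rule group_SL)
  fix C assume "C \<in> image_cosets p q V"
  then obtain g l b where g: "g \<in> carrier (SL ?n)" "l \<in> Lgrp p q" "b \<in> invertible_triangular ?n"
    "g = l * V * b" "C = inv\<^bsub>SL ?n\<^esub> g <#\<^bsub>SL ?n\<^esub> Pgrp p q" by (auto simp: image_cosets_def)
  obtain x d where xd: "x \<in> parabolic p q" "d \<in> invertible_triangular ?n" "V = x * W * d"
    using e by (auto simp: double_coset_equiv_def)
  have l: "l \<in> parabolic p q" using g(2) Lgrp_subset_Pgrp Pgrp_iff_parabolic by blast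
  note c = parabolicD[OF l] parabolicD[OF xd(1)] invertible_triangularD[OF g(3)] invertible_triangularD[OF xd(2)]
  have lx: "l * x \<in> parabolic p q" by (rule parabolic_mult[OF l xd(1)])
  have "inverse (det (l * x)) \<noteq> 0" using lx by (simp add: parabolic_def)
  then obtain z where z: "z ^ ?n = inverse (det (l * x))" and z0: "z \<noteq> 0"
    using complex_nth_root_exists[OF n] by blast
  \<comment> \<open>The product \<open>(l * x) * W * (d * b)\<close> is split as
    \<open>y * h\<close>, with \<open>z\<close> in the parabolic factor and its inverse in the
    triangular one. By the choice of \<open>z\<close> the matrix \<open>y\<close> has determinant 1,
    and then so has \<open>h\<close>.\<close>
  define y where "y = z \<cdot>\<^sub>m (l * x)"
  define h where "h = W * (inverse z \<cdot>\<^sub>m (d * b))"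
  have hc: "h \<in> carrier_mat ?n ?n" using W c by (simp add: h_def)
  have yP: "y \<in> Pgrp p q"
    unfolding Pgrp_iff_parabolic y_def using smult_parabolic[OF lx z0] z lx c by (auto simp: parabolic_def)
  then have yc: "y \<in> carrier (SL ?n)" using Pgrp_subset by blast
  have "y * h = inverse z \<cdot>\<^sub>m (z \<cdot>\<^sub>m (l * x * (W * (d * b))))"
    unfolding y_def h_def using W c
    by (simp add: mult_smult_assoc_mat[of _ ?n ?n _ ?n] mult_smult_distrib[of _ ?n ?n _ ?n])
  also have "\<dots> = l * x * (W * (d * b))" using z0 by (auto intro!: eq_matI)
  also have "\<dots> = g" unfolding g(4) xd(3) using W c by (simp add: assoc_mult_mat[of _ ?n ?n _ ?n _ ?n])
  finally have gy: "g = y * h" ..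
  have "det h = 1"
    using det_mult[of y ?n h] hc yc g(1) gy by (simp add: SL_simps)
  then have h: "h \<in> carrier (SL ?n)" using hc by (simp add: SL_simps)
  have db: "inverse z \<cdot>\<^sub>m (d * b) \<in> invertible_triangular ?n"
    using smult_invertible_triangular[OF invertible_triangular_mult[OF xd(2) g(3)]] z0 by simp
  have hW: "h = 1\<^sub>m ?n * W * (inverse z \<cdot>\<^sub>m (d * b))" using W by (simp add: h_def)
  \<comment> \<open>Inversion puts \<open>y\<close> on the right, where \<open>Pgrp\<close> absorbs
    it: \<open>g\<close> and \<open>h\<close> give the same coset.\<close>
  have "inv\<^bsub>SL ?n\<^esub> g = inv\<^bsub>SL ?n\<^esub> h \<otimes>\<^bsub>SL ?n\<^esub> inv\<^bsub>SL ?n\<^esub> y"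
    using inv_mult_group[OF yc h] gy by (simp add: SL_simps(1))
  moreover have "inv\<^bsub>SL ?n\<^esub> y <#\<^bsub>SL ?n\<^esub> Pgrp p q = Pgrp p q"
    using subgroup.m_inv_closed[OF subgroup_Pgrp yP] yc subgroup_Pgrp by (intro coset_join3) auto
  ultimately have "C = inv\<^bsub>SL ?n\<^esub> h <#\<^bsub>SL ?n\<^esub> Pgrp p q"
    using g(5) lcos_m_assoc[OF Pgrp_subset, of "inv\<^bsub>SL ?n\<^esub> h" "inv\<^bsub>SL ?n\<^esub> y"] h yc by simp
  then show "C \<in> image_cosets p q W"
    unfolding image_cosets_def using h hW db one_in_Lgrp by blast
qed

text \<open>A single coset suffices. Scale \<open>V\<close> to a matrix \<open>g\<close> of
  determinant 1; its coset is also that of some \<open>h = l * W * d\<close>. Equality of the cosets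
  of the inverses means \<open>g = x * h\<close> with \<open>x\<close> in \<open>Pgrp\<close>, and
  undoing the scaling expresses \<open>V\<close> through \<open>W\<close>.\<close>

lemma image_cosets_eqD:
  assumes n: "p + q > 0" and V: "V \<in> carrier_mat (p + q) (p + q)" "det V \<noteq> 0"
    and W: "W \<in> carrier_mat (p + q) (p + q)"
    and e: "image_cosets p q V \<subseteq> image_cosets p q W"
  shows "double_coset_equiv p q V W"
proof -
  let ?n = "p + q"
  interpret group "SL ?n" by (rule group_SL)
  have "inverse (det V) \<noteq> 0" using V by simp
  then obtain z where z: "z ^ ?n = inverse (det V)" and z0: "z \<noteq> 0"
    using complex_nth_root_exists[OF n] by blast
  \<comment> \<open>A scalar matrix is triangular, and the root \<open>z\<close> makes the
    determinant of \<open>V * b\<close> equal to 1.\<close>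
  define b where "b = z \<cdot>\<^sub>m (1\<^sub>m ?n :: complex mat)"
  have b: "b \<in> invertible_triangular ?n" unfolding b_def by (rule smult_invertible_triangular[OF one_invertible_triangular z0])
  note bc = invertible_triangularD[OF b]
  define g where "g = 1\<^sub>m ?n * V * b"
  have "det g = 1" using det_mult[OF V(1) bc] z V by (simp add: g_def b_def)
  then have g: "g \<in> carrier (SL ?n)" using V bc by (simp add: SL_simps g_def)
  have "inv\<^bsub>SL ?n\<^esub> g <#\<^bsub>SL ?n\<^esub> Pgrp p q \<in> image_cosets p q V"
    unfolding image_cosets_def using g b one_in_Lgrp g_def by blast
  with e have "inv\<^bsub>SL ?n\<^esub> g <#\<^bsub>SL ?n\<^esub> Pgrp p q \<in> image_cosets p q W" ..
  then obtain h l d where h: "h \<in> carrier (SL ?n)" "l \<in> Lgrp p q" "d \<in> invertible_triangular ?n"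
    "h = l * W * d" "inv\<^bsub>SL ?n\<^esub> g <#\<^bsub>SL ?n\<^esub> Pgrp p q = inv\<^bsub>SL ?n\<^esub> h <#\<^bsub>SL ?n\<^esub> Pgrp p q"
    unfolding image_cosets_def by blast
  have "inv\<^bsub>SL ?n\<^esub> h \<in> inv\<^bsub>SL ?n\<^esub> g <#\<^bsub>SL ?n\<^esub> Pgrp p q"
    unfolding h(5) using r_one[OF inv_closed[OF h(1)]] subgroup.one_closed[OF subgroup_Pgrp, of p q]
    by (force simp: l_coset_def)
  then obtain x where x: "x \<in> Pgrp p q" "inv\<^bsub>SL ?n\<^esub> h = inv\<^bsub>SL ?n\<^esub> g \<otimes>\<^bsub>SL ?n\<^esub> x"
    by (auto simp: l_coset_def)
  have xS: "x \<in> carrier (SL ?n)" using x Pgrp_subset by blast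
  have "g \<otimes>\<^bsub>SL ?n\<^esub> inv\<^bsub>SL ?n\<^esub> h = x"
    unfolding x(2) using g xS by (simp add: m_assoc[symmetric])
  then have "g = x \<otimes>\<^bsub>SL ?n\<^esub> h" using g h xS by (metis inv_solve_right')
  then have gx: "V * b = x * (l * W * d)" using V bc h(4) by (simp add: SL_simps(1) g_def)
  have xp: "x \<in> parabolic p q" "l \<in> parabolic p q"
    using x(1) h(2) Lgrp_subset_Pgrp Pgrp_iff_parabolic by blast+
  obtain b' where b': "b' \<in> invertible_triangular ?n" "b * b' = 1\<^sub>m ?n"
    using invertible_triangular_inverse[OF b] by metis
  note c = parabolicD[OF xp(1)] parabolicD[OF xp(2)] invertible_triangularD[OF h(3)] invertible_triangularD[OF b'(1)]
  have "V = V * b * b'" using V bc c b' by (simp add: assoc_mult_mat[of _ ?n ?n _ ?n _ ?n])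
  also have "\<dots> = (x * l) * W * (d * b')"
    unfolding gx using W c by (simp add: assoc_mult_mat[of _ ?n ?n _ ?n _ ?n])
  finally show ?thesis
    using parabolic_mult[OF xp] invertible_triangular_mult[OF h(3) b'(1)]
    unfolding double_coset_equiv_def by blast
qed

theorem proposition4p13:
  fixes p q :: nat and \<gamma> \<tau> :: clan and \<sigma> \<rho> :: "nat \<Rightarrow> nat"
  assumes "p > 0" and "q > 0"
    and "is_clan p q \<gamma>" and "is_clan p q \<tau>"
    and "admissible p q \<gamma> \<sigma>" and "admissible p q \<tau> \<rho>"
  shows "proj p q ` R_orbit p q \<gamma> \<sigma> = proj p q ` R_orbit p q \<tau> \<rho>
         \<longleftrightarrow> base_clan \<gamma> = base_clan \<tau>"
proof -
  let ?n = "p + q" and ?V = "clan_mat \<gamma> \<sigma>" and ?W = "clan_mat \<tau> \<rho>"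
  let ?S = "permutation_mat (p + q) \<sigma> :: complex mat" and ?T = "permutation_mat (p + q) \<rho> :: complex mat"
  have n: "?n > 0" using assms(1) by simp
  have len: "length \<gamma> = ?n" "length \<tau> = ?n" using assms(3,4) by (simp_all add: is_clan_def)
  have V: "?V \<in> carrier_mat ?n ?n" "det ?V \<noteq> 0"
    using clan_mat_carrier[of \<gamma> \<sigma>] len det_clan_mat_neq_0[OF assms(3,5)] by auto
  have W: "?W \<in> carrier_mat ?n ?n"
    using clan_mat_carrier[of \<tau> \<rho>] len by auto
  note VS = clan_mat_equiv_permutation_mat[OF assms(3,5)]
  note WT = clan_mat_equiv_permutation_mat[OF assms(4,6)]
  note SV = double_coset_equiv_sym[OF VS permutation_mat_carrier]
  note TW = double_coset_equiv_sym[OF WT permutation_mat_carrier]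
  have perm: "\<sigma> permutes {0..<?n}" "\<rho> permutes {0..<?n}" using assms(5,6) by (auto simp: admissible_def)
  have "proj p q ` R_orbit p q \<gamma> \<sigma> = proj p q ` R_orbit p q \<tau> \<rho>
      \<longleftrightarrow> image_cosets p q ?V = image_cosets p q ?W"
    unfolding proj_R_orbit[OF assms(3,5)] proj_R_orbit[OF assms(4,6)] ..
  \<comment> \<open>Equality of the images yields one inclusion and thus equivalence; conversely,
    symmetry of the equivalence gives both inclusions.\<close>
  also have "\<dots> \<longleftrightarrow> double_coset_equiv p q ?V ?W"
    using image_cosets_eqD[OF n V W] image_cosets_mono[OF n W] image_cosets_mono[OF n V(1)]
      double_coset_equiv_sym[OF _ W] by blast
  \<comment> \<open>Here the matchings drop out: each clan matrix is replaced by its permutation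
    matrix within the same double coset.\<close>
  also have "\<dots> \<longleftrightarrow> double_coset_equiv p q ?S ?T"
    using double_coset_equiv_trans[OF VS _ V(1)] double_coset_equiv_trans[OF SV _ W]
      double_coset_equiv_trans[OF _ WT permutation_mat_carrier]
      double_coset_equiv_trans[OF VS _ W] double_coset_equiv_trans[OF _ TW W]
      double_coset_equiv_trans[OF SV _ permutation_mat_carrier] by blast
  \<comment> \<open>Admissibility ties \<open>\<sigma> i < p\<close> to the signature, so the result
    does not depend on the chosen permutations.\<close>
  also have "\<dots> \<longleftrightarrow> (\<forall>i<?n. signature \<gamma> i = Plus \<longleftrightarrow> signature \<tau> i = Plus)"
    using double_coset_equiv_permutation_mat_iff[OF perm, where 'a = complex]
      admissible_less_iff[OF assms(5)] admissible_less_iff[OF assms(6)] by simp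
  \<comment> \<open>Signatures take only the two values \<open>Plus\<close> and
    \<open>Minus\<close>, so agreement on one of them is equality.\<close>
  also have "\<dots> \<longleftrightarrow> (\<forall>i<?n. signature \<gamma> i = signature \<tau> i)"
    using signature_not_Num by metis
  also have "\<dots> \<longleftrightarrow> base_clan \<gamma> = base_clan \<tau>"
    by (auto simp: base_clan_def len)
  finally show ?thesis .
qed

end
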